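(* Let $m,n\geqslant 1$, let $\mathbf{k}$ be a differential field of characteristic zero with $m$ commuting derivations, let $Y=\{y_1,\dots,y_n\}$ be differential indeterminates, let $w$ be a weight on $\Theta$, and fix a weighted ranking (with respect to $w$) on $\Theta Y$. Let $F,K\subseteq \mathbf{k}\{Y\}$ be finite subsets, let $h=\mathcal{W}(F\cup K)$, let $f(i)=h f_i$ for $i\geqslant 1$, where $\{f_0,f_1,f_2,\dots\}=\{0,1,1,2,3,5,\dots\}$ is the Fibonacci sequence, let $L=\mathfrak{L}^n_{f,m}$, and let $\mathcal{A}=\textsf{Rosenfeld-Gröbner}(F,K)$. Then $$\mathcal{W}\left(\bigcup_{(A,H)\in\mathcal{A}}(A\cup H)\right)\leqslant h f_{L+1}.$$
   Context: Differential algebra. $\mathbf{k}$ is a differential field of characteristic zero with commuting derivations $\Delta=\{\partial_1,\dots,\partial_m\}$; $\Theta=\{\partial_1^{i_1}\cdots\partial_m^{i_m}: i_j\in\mathbb{Z}_{\geqslant 0}\}$; $\Theta Y=\{\theta y:\theta\in\Theta,y\in Y\}$; $\mathbf{k}\{Y\}=\mathbf{k}[\theta y:\theta y\in\Theta Y]$ with the natural derivations. For fixed positive integers $c_1,\dots,c_m$, the weight is $w(\partial_1^{i_1}\cdots\partial_m^{i_m})=c_1i_1+\cdots+c_mi_m$, and $w(\theta y)=w(\theta)$. For $f\in\mathbf{k}\{Y\}\setminus\mathbf{k}$, $w(f)$ is the maximum weight of the derivatives appearing in $f$; for $f\in\mathbf{k}$ put $w(f)=0$. For a finite set $A$, $\mathcal{W}(A)=\max\{w(f):f\in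 A\}$, with $\mathcal{W}(\varnothing)=0$. A ranking is a total order $<$ on $\Theta Y$ with $u<\theta u$ and $u<v\Rightarrow\theta u<\theta v$ for all $u,v\in\Theta Y$ and $\theta\in\Theta$, $\theta\neq\mathrm{id}$; it is a weighted ranking if $w(u)<w(v)$ implies $u<v$. For $f\in\mathbf{k}\{Y\}\setminus\mathbf{k}$: the leader $\mathrm{lead}(f)$ is the highest-ranked derivative in $f$; the initial $\mathrm{init}(f)$ is the leading coefficient of $f$ as a univariate polynomial in $\mathrm{lead}(f)$; the separant $\mathrm{sep}(f)$ is the initial of $\delta f$ for any $\delta\in\Delta$ (i.e. $\partial f/\partial\,\mathrm{lead}(f)$); $\mathrm{rank}(f)=\mathrm{lead}(f)^d$ with $d=\deg_{\mathrm{lead}(f)}(f)$, ranks being compared first by leader, then by $d$. For a set $A\subseteq\mathbf{k}\{Y\}\setminus\mathbf{k}$: $\mathfrak{L}(A)$ is its set of leaders, $S_A$ its set of separants, $H_A$ its set of initials and separants. $f$ is partially reduced with respect to $g$ if no proper derivative of $\mathrm{lead}(g)$ appears in $f$; it is reduced if moreover $\deg_{\mathrm{lead}(g)}(f)<\deg_{\mathrm{lead}(g)}(g)$; (partially) reduced with respect to a set means with respect to all its elements. $A$ is autoreduced if each element is reduced with respect to every other, and weak d-triangular if $\mathfrak{L}(A)$ is autoreduced (then distinct elements have distinct leaders, and $A_u$ denotes the element with leader $u$). $S^\infty$ is the multiplicative set generated by $S$ and $1$; $[A]$ is the differential ideal generated by $A$. For $A$ weak d-triangular, $\mathrm{pd\text{-}red}(f,A)$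 (resp. $\mathrm{d\text{-}red}(f,A)$) is a polynomial $f_1$ partially reduced (resp. $f_2$ reduced) with respect to $A$, with $sf\equiv f_1 \bmod [A]$ for some $s\in S_A^\infty$ (resp. $hf\equiv f_2\bmod[A]$ for some $h\in H_A^\infty$), computed by fixed (standard) algorithms that never increase rank, hence never increase weight. If $u=\partial_1^{i_1}\cdots\partial_m^{i_m}y$, $v=\partial_1^{j_1}\cdots\partial_m^{j_m}y$ with the same $y\in Y$, then $\mathrm{lcd}(u,v)=\partial_1^{\max(i_1,j_1)}\cdots\partial_m^{\max(i_m,j_m)}y$. $\Delta(f,g)=0$ if $\mathrm{lead}(f),\mathrm{lead}(g)$ are derivatives of different elements of $Y$; otherwise $\Delta(f,g)=\mathrm{sep}(g)\phi(f)-\mathrm{sep}(f)\psi(g)$, where $\phi,\psi\in\Theta$ satisfy $\phi(\mathrm{lead}(f))=\psi(\mathrm{lead}(g))=\mathrm{lcd}(\mathrm{lead}(f),\mathrm{lead}(g))$. The algorithm. $\textsf{Rosenfeld-Gröbner}(F,K)$ maintains a set $\mathcal{S}$ of 4-tuples $(G,D,A,H)$ of finite subsets of $\mathbf{k}\{Y\}$ ($A$ weak d-triangular), initially $\mathcal{S}=\{(F,\varnothing,\varnothing,K)\}$, and an output set $\mathcal{A}$, initially empty. While $\mathcal{S}\neq\varnothing$: remove some $(G,D,A,H)$ from $\mathcal{S}$. If $G\cup D=\varnothing$, replace $\mathcal{A}$ by $\mathcal{A}\cup\textsf{auto-partial-reduce}(A,H)$. Otherwise choose $p\in G\cup D$,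 put $\bar G=G\setminus\{p\}$, $\bar D=D\setminus\{p\}$, $\bar p=\mathrm{d\text{-}red}(p,A)$. If $\bar p=0$, add $(\bar G,\bar D,A,H)$ to $\mathcal{S}$. If $\bar p\in\mathbf{k}\setminus\{0\}$, add nothing. If $\bar p\notin\mathbf{k}$, put $\bar p_i=\bar p-\mathrm{init}(\bar p)\,\mathrm{rank}(\bar p)$, $\bar p_s=\deg_{\mathrm{lead}(\bar p)}(\bar p)\,\bar p-\mathrm{lead}(\bar p)\,\mathrm{sep}(\bar p)$ and add to $\mathcal{S}$ the three tuples $\textsf{update}(\bar G,\bar D,A,H,\bar p)$, $(\bar G\cup\{\bar p_s,\mathrm{sep}(\bar p)\},\bar D,A,H\cup\{\mathrm{init}(\bar p)\})$, $(\bar G\cup\{\bar p_i,\mathrm{init}(\bar p)\},\bar D,A,H)$. When $\mathcal{S}=\varnothing$, return $\mathcal{A}$. $\textsf{update}(G,D,A,H,p)$: with $u=\mathrm{lead}(p)$, $G_A=\{a\in A:\mathrm{lead}(a)\in\Theta u\}$, $\bar A=A\setminus G_A$, return $\bigl(G\cup G_A,\ (D\cup\{\Delta(p,a):a\in\bar A\})\setminus\{0\},\ \bar A\cup\{p\},\ H\cup\{\mathrm{sep}(p),\mathrm{init}(p)\}\bigr)$. $\textsf{auto-partial-reduce}(A,H)$: start with $B=\varnothing$; for $u\in\mathfrak{L}(A)$ in increasing order, let $b=\mathrm{pd\text{-}red}(A_u,B)$; if $\mathrm{rank}(b)=\mathrm{rank}(A_u)$ add $b$ to $B$, otherwise return $\varnothing$.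 Then let $K'=H_B\cup\{\mathrm{pd\text{-}red}(q,B):q\in H\setminus H_A\}$; return $\varnothing$ if $0\in K'$, otherwise return $\{(B,K')\}$. Antichain lengths. Let $\mathfrak{n}=\{1,\dots,n\}$. On $\mathbb{Z}_{\geqslant 0}^m\times\mathfrak{n}$ let $((i_1,\dots,i_m),k)\preccurlyeq((j_1,\dots,j_m),l)$ iff $k=l$ and $i_r\leqslant j_r$ for all $r$; the degree of $((i_1,\dots,i_m),k)$ is $i_1+\cdots+i_m$. An antichain sequence is a sequence $s_1,s_2,\dots$ of pairwise incomparable elements (all such sequences are finite). A function $f$ on $\mathbb{Z}_{>0}$ bounds its degree growth if $\deg(s_i)\leqslant f(i)$ for every term $s_i$. $\mathfrak{L}^n_{f,m}$ denotes the maximal length of an antichain sequence of $\mathbb{Z}_{\geqslant 0}^m\times\mathfrak{n}$ with degree growth bounded by $f$ (this maximum exists). *)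

theory Defs
  imports Complex_Main "HOL-Library.Poly_Mapping" "HOL-Number_Theory.Fib"
begin

text \<open>
  The derivations are indexed by a finite type \<open>'m\<close> and the differential indeterminates are the
  elements of a finite type \<open>'n\<close>, so that $m = \mathrm{CARD}('m) \ge 1$ and
  $n = \mathrm{CARD}('n) \ge 1$. A derivative operator is its exponent vector \<open>\<theta> :: 'm \<Rightarrow> nat\<close>, and
  the pair \<open>(\<theta>, y)\<close> stands for the derivative $\theta y$.
\<close>

type_synonym ('m, 'n) der = "('m \<Rightarrow> nat) \<times> 'n"
type_synonym ('m, 'n, 'k) dpoly = "((('m, 'n) der) \<Rightarrow>\<^sub>0 nat) \<Rightarrow>\<^sub>0 'k"

locale differential_field =
  fixes \<delta> :: "'m::finite \<Rightarrow> 'k::field_char_0 \<Rightarrow> 'k"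
  assumes deriv_add: "\<delta> i (a + b) = \<delta> i a + \<delta> i b"
    and deriv_mult: "\<delta> i (a * b) = \<delta> i a * b + a * \<delta> i b"
    and deriv_commute: "\<delta> i (\<delta> j a) = \<delta> j (\<delta> i a)"


section \<open>Derivatives, weights, rankings\<close>

definition op_act :: "('m \<Rightarrow> nat) \<Rightarrow> ('m, 'n) der \<Rightarrow> ('m, 'n) der" where
  "op_act \<theta> u = (\<lambda>i. \<theta> i + fst u i, snd u)"

definition unit_op :: "'m \<Rightarrow> 'm \<Rightarrow> nat" where
  "unit_op i = (\<lambda>j. if j = i then 1 else 0)"

definition wt :: "('m::finite \<Rightarrow> nat) \<Rightarrow> ('m, 'n) der \<Rightarrow> nat" where
  "wt c u = (\<Sum>i\<in>UNIV. c i * fst u i)"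

text \<open>\<open>lt u v\<close> means $u < v$.\<close>

definition ranking :: "(('m, 'n) der \<Rightarrow> ('m, 'n) der \<Rightarrow> bool) \<Rightarrow> bool" where
  "ranking lt \<longleftrightarrow>
     irreflp lt \<and> transp lt \<and> totalp lt \<and>
     (\<forall>\<theta> u. \<theta> \<noteq> (\<lambda>_. 0) \<longrightarrow> lt u (op_act \<theta> u)) \<and>
     (\<forall>\<theta> u v. \<theta> \<noteq> (\<lambda>_. 0) \<longrightarrow> lt u v \<longrightarrow> lt (op_act \<theta> u) (op_act \<theta> v))"

definition weighted_ranking ::
  "('m::finite \<Rightarrow> nat) \<Rightarrow> (('m, 'n) der \<Rightarrow> ('m, 'n) der \<Rightarrow> bool) \<Rightarrow> bool" where
  "weighted_ranking c lt \<longleftrightarrow> ranking lt \<and> (\<forall>u v. wt c u < wt c v \<longrightarrow> lt u v)"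


section \<open>The ring of differential polynomials\<close>

definition const :: "'k \<Rightarrow> ('m, 'n, 'k::field_char_0) dpoly" where
  "const a = Poly_Mapping.single 0 a"

definition ground :: "('m, 'n, 'k::field_char_0) dpoly set" where
  "ground = range const"

definition var :: "('m, 'n) der \<Rightarrow> ('m, 'n, 'k::field_char_0) dpoly" where
  "var u = Poly_Mapping.single (Poly_Mapping.single u 1) 1"

text \<open>The derivatives appearing in a differential polynomial.\<close>

definition ders :: "('m, 'n, 'k::field_char_0) dpoly \<Rightarrow> ('m, 'n) der set" where
  "ders f = (\<Union>\<mu>\<in>Poly_Mapping.keys f. Poly_Mapping.keys \<mu>)"

definition deg_in :: "('m, 'n) der \<Rightarrow> ('m, 'n, 'k::field_char_0) dpoly \<Rightarrow> nat" where
  "deg_in u f = Max (insert 0 ((\<lambda>\<mu>. Poly_Mapping.lookup \<mu> u) ` Poly_Mapping.keys f))"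

text \<open>The coefficient of $u^d$ in \<open>f\<close>, viewed as a univariate polynomial in \<open>u\<close>.\<close>

definition coeff_in ::
  "('m, 'n) der \<Rightarrow> nat \<Rightarrow> ('m, 'n, 'k::field_char_0) dpoly \<Rightarrow> ('m, 'n, 'k) dpoly" where
  "coeff_in u d f =
     (\<Sum>\<mu>\<in>{\<mu>\<in>Poly_Mapping.keys f. Poly_Mapping.lookup \<mu> u = d}.
        Poly_Mapping.single (\<mu> - Poly_Mapping.single u d) (Poly_Mapping.lookup f \<mu>))"

text \<open>The formal partial derivative $\partial f / \partial u$.\<close>

definition partial_der ::
  "('m, 'n) der \<Rightarrow> ('m, 'n, 'k::field_char_0) dpoly \<Rightarrow> ('m, 'n, 'k) dpoly" where
  "partial_der u f =
     (\<Sum>\<mu>\<in>Poly_Mapping.keys f.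
        Poly_Mapping.single (\<mu> - Poly_Mapping.single u 1)
          (of_nat (Poly_Mapping.lookup \<mu> u) * Poly_Mapping.lookup f \<mu>))"

text \<open>
  The natural derivation, i.e. the unique one that extends \<open>\<delta> i\<close> and maps the derivative $u$ to
  $\partial_i u$: by the chain rule it is $f \mapsto f^{\delta_i} + \sum_u (\partial f/\partial u)\,\partial_i u$,
  where $f^{\delta_i}$ is obtained by applying $\delta_i$ to the coefficients.
\<close>

definition dderiv ::
  "('m \<Rightarrow> 'k \<Rightarrow> 'k) \<Rightarrow> 'm \<Rightarrow> ('m, 'n, 'k::field_char_0) dpoly \<Rightarrow> ('m, 'n, 'k) dpoly" where
  "dderiv \<delta> i f =
     Poly_Mapping.map (\<delta> i) f + (\<Sum>u\<in>ders f. partial_der u f * var (op_act (unit_op i) u))"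

text \<open>The fold is well defined because the derivations commute.\<close>

definition dop ::
  "('m::finite \<Rightarrow> 'k \<Rightarrow> 'k) \<Rightarrow> ('m \<Rightarrow> nat) \<Rightarrow> ('m, 'n, 'k::field_char_0) dpoly \<Rightarrow> ('m, 'n, 'k) dpoly"
  where "dop \<delta> \<theta> f = Finite_Set.fold (\<lambda>i. dderiv \<delta> i ^^ \<theta> i) f UNIV"

definition weight :: "('m::finite \<Rightarrow> nat) \<Rightarrow> ('m, 'n, 'k::field_char_0) dpoly \<Rightarrow> nat" where
  "weight c f = Max (insert 0 (wt c ` ders f))"

definition max_weight :: "('m::finite \<Rightarrow> nat) \<Rightarrow> ('m, 'n, 'k::field_char_0) dpoly set \<Rightarrow> nat" where
  "max_weight c A = Max (insert 0 (weight c ` A))"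

inductive_set diff_ideal ::
  "('m \<Rightarrow> 'k \<Rightarrow> 'k) \<Rightarrow> ('m, 'n, 'k::field_char_0) dpoly set \<Rightarrow> ('m, 'n, 'k) dpoly set"
  for \<delta> A where
  zero: "0 \<in> diff_ideal \<delta> A"
| gen: "a \<in> A \<Longrightarrow> a \<in> diff_ideal \<delta> A"
| add: "f \<in> diff_ideal \<delta> A \<Longrightarrow> g \<in> diff_ideal \<delta> A \<Longrightarrow> f + g \<in> diff_ideal \<delta> A"
| mult: "f \<in> diff_ideal \<delta> A \<Longrightarrow> g * f \<in> diff_ideal \<delta> A"
| deriv: "f \<in> diff_ideal \<delta> A \<Longrightarrow> dderiv \<delta> i f \<in> diff_ideal \<delta> A"

inductive_set mult_closure :: "'r::comm_ring_1 set \<Rightarrow> 'r set" for S where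
  one: "1 \<in> mult_closure S"
| gen: "s \<in> S \<Longrightarrow> s \<in> mult_closure S"
| mult: "s \<in> mult_closure S \<Longrightarrow> t \<in> mult_closure S \<Longrightarrow> s * t \<in> mult_closure S"


section \<open>Leaders, initials, separants and reducedness\<close>

text \<open>Leaders, and what is built on them, are meaningful only for polynomials outside \<open>ground\<close>.\<close>

definition lead ::
  "(('m, 'n) der \<Rightarrow> ('m, 'n) der \<Rightarrow> bool) \<Rightarrow> ('m, 'n, 'k::field_char_0) dpoly \<Rightarrow> ('m, 'n) der" where
  "lead lt f = (THE u. u \<in> ders f \<and> (\<forall>v\<in>ders f. v \<noteq> u \<longrightarrow> lt v u))"

definition init ::
  "(('m, 'n) der \<Rightarrow> ('m, 'n) der \<Rightarrow> bool) \<Rightarrow> ('m, 'n, 'k::field_char_0) dpoly \<Rightarrow> ('m, 'n, 'k) dpoly"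
  where "init lt f = coeff_in (lead lt f) (deg_in (lead lt f) f) f"

definition sep ::
  "(('m, 'n) der \<Rightarrow> ('m, 'n) der \<Rightarrow> bool) \<Rightarrow> ('m, 'n, 'k::field_char_0) dpoly \<Rightarrow> ('m, 'n, 'k) dpoly"
  where "sep lt f = partial_der (lead lt f) f"

definition rank ::
  "(('m, 'n) der \<Rightarrow> ('m, 'n) der \<Rightarrow> bool) \<Rightarrow> ('m, 'n, 'k::field_char_0) dpoly \<Rightarrow> ('m, 'n, 'k) dpoly"
  where "rank lt f = var (lead lt f) ^ deg_in (lead lt f) f"

definition seps ::
  "(('m, 'n) der \<Rightarrow> ('m, 'n) der \<Rightarrow> bool) \<Rightarrow> ('m, 'n, 'k::field_char_0) dpoly set
    \<Rightarrow> ('m, 'n, 'k) dpoly set"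
  where "seps lt A = sep lt ` A"

definition inits_seps ::
  "(('m, 'n) der \<Rightarrow> ('m, 'n) der \<Rightarrow> bool) \<Rightarrow> ('m, 'n, 'k::field_char_0) dpoly set
    \<Rightarrow> ('m, 'n, 'k) dpoly set"
  where "inits_seps lt A = init lt ` A \<union> sep lt ` A"

definition partially_reduced ::
  "(('m, 'n) der \<Rightarrow> ('m, 'n) der \<Rightarrow> bool) \<Rightarrow> ('m, 'n, 'k::field_char_0) dpoly
    \<Rightarrow> ('m, 'n, 'k) dpoly \<Rightarrow> bool"
  where "partially_reduced lt f g \<longleftrightarrow> (\<forall>\<theta>. \<theta> \<noteq> (\<lambda>_. 0) \<longrightarrow> op_act \<theta> (lead lt g) \<notin> ders f)"

definition reduced ::
  "(('m, 'n) der \<Rightarrow> ('m, 'n) der \<Rightarrow> bool) \<Rightarrow> ('m, 'n, 'k::field_char_0) dpoly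
    \<Rightarrow> ('m, 'n, 'k) dpoly \<Rightarrow> bool"
  where "reduced lt f g \<longleftrightarrow>
    partially_reduced lt f g \<and> deg_in (lead lt g) f < deg_in (lead lt g) g"

definition autoreduced ::
  "(('m, 'n) der \<Rightarrow> ('m, 'n) der \<Rightarrow> bool) \<Rightarrow> ('m, 'n, 'k::field_char_0) dpoly set \<Rightarrow> bool" where
  "autoreduced lt A \<longleftrightarrow> A \<inter> ground = {} \<and> (\<forall>f\<in>A. \<forall>g\<in>A. f \<noteq> g \<longrightarrow> reduced lt f g)"

text \<open>
  The leaders are taken as a family, so that different elements have different leaders;
  for the bare set of leaders this would not follow from its being autoreduced.
\<close>

definition weak_d_triangular ::
  "(('m, 'n) der \<Rightarrow> ('m, 'n) der \<Rightarrow> bool) \<Rightarrow> ('m, 'n, 'k::field_char_0) dpoly set \<Rightarrow> bool" where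
  "weak_d_triangular lt A \<longleftrightarrow>
     A \<inter> ground = {} \<and> inj_on (lead lt) A \<and>
     autoreduced lt ((\<lambda>a. var (lead lt a) :: ('m, 'n, 'k) dpoly) ` A)"


section \<open>Differential reduction\<close>

definition rank_not_above ::
  "(('m, 'n) der \<Rightarrow> ('m, 'n) der \<Rightarrow> bool) \<Rightarrow> ('m, 'n, 'k::field_char_0) dpoly
    \<Rightarrow> ('m, 'n, 'k) dpoly \<Rightarrow> bool"
  where "rank_not_above lt f g \<longleftrightarrow>
    f \<in> ground \<or>
    (g \<notin> ground \<and>
      (lt (lead lt f) (lead lt g) \<or>
       lead lt f = lead lt g \<and> deg_in (lead lt f) f \<le> deg_in (lead lt g) g))"

text \<open>
  The reduction procedures are arbitrary functions meeting the specification of (partial)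
  differential reduction that never increase the rank; the usual reduction algorithms are instances.
\<close>

definition pd_reduction ::
  "('m \<Rightarrow> 'k \<Rightarrow> 'k) \<Rightarrow> (('m, 'n) der \<Rightarrow> ('m, 'n) der \<Rightarrow> bool)
    \<Rightarrow> (('m, 'n, 'k::field_char_0) dpoly \<Rightarrow> ('m, 'n, 'k) dpoly set \<Rightarrow> ('m, 'n, 'k) dpoly) \<Rightarrow> bool"
  where "pd_reduction \<delta> lt pd_red \<longleftrightarrow>
    (\<forall>f A. finite A \<and> weak_d_triangular lt A \<longrightarrow>
       (\<forall>a\<in>A. partially_reduced lt (pd_red f A) a) \<and>
       (\<exists>s\<in>mult_closure (seps lt A). s * f - pd_red f A \<in> diff_ideal \<delta> A) \<and>
       rank_not_above lt (pd_red f A) f)"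

definition d_reduction ::
  "('m \<Rightarrow> 'k \<Rightarrow> 'k) \<Rightarrow> (('m, 'n) der \<Rightarrow> ('m, 'n) der \<Rightarrow> bool)
    \<Rightarrow> (('m, 'n, 'k::field_char_0) dpoly \<Rightarrow> ('m, 'n, 'k) dpoly set \<Rightarrow> ('m, 'n, 'k) dpoly) \<Rightarrow> bool"
  where "d_reduction \<delta> lt d_red \<longleftrightarrow>
    (\<forall>f A. finite A \<and> weak_d_triangular lt A \<longrightarrow>
       (\<forall>a\<in>A. reduced lt (d_red f A) a) \<and>
       (\<exists>h\<in>mult_closure (inits_seps lt A). h * f - d_red f A \<in> diff_ideal \<delta> A) \<and>
       rank_not_above lt (d_red f A) f)"

definition lcd_op :: "('m, 'n) der \<Rightarrow> ('m, 'n) der \<Rightarrow> 'm \<Rightarrow> nat" where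
  "lcd_op u v = (\<lambda>i. max (fst u i) (fst v i))"

text \<open>The operators applied below are $\mathrm{lcd}/\mathrm{lead}(f)$ and $\mathrm{lcd}/\mathrm{lead}(g)$.\<close>

definition delta_poly ::
  "('m::finite \<Rightarrow> 'k \<Rightarrow> 'k) \<Rightarrow> (('m, 'n) der \<Rightarrow> ('m, 'n) der \<Rightarrow> bool)
    \<Rightarrow> ('m, 'n, 'k::field_char_0) dpoly \<Rightarrow> ('m, 'n, 'k) dpoly \<Rightarrow> ('m, 'n, 'k) dpoly"
  where "delta_poly \<delta> lt f g =
    (let u = lead lt f; v = lead lt g in
     if snd u \<noteq> snd v then 0
     else sep lt g * dop \<delta> (\<lambda>i. lcd_op u v i - fst u i) f
          - sep lt f * dop \<delta> (\<lambda>i. lcd_op u v i - fst v i) g)"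


section \<open>The Rosenfeld-Groebner algorithm\<close>

type_synonym ('m, 'n, 'k) rg_tuple =
  "('m, 'n, 'k) dpoly set \<times> ('m, 'n, 'k) dpoly set \<times> ('m, 'n, 'k) dpoly set \<times> ('m, 'n, 'k) dpoly set"

definition rg_update ::
  "('m::finite \<Rightarrow> 'k \<Rightarrow> 'k) \<Rightarrow> (('m, 'n) der \<Rightarrow> ('m, 'n) der \<Rightarrow> bool)
    \<Rightarrow> ('m, 'n, 'k) dpoly set \<Rightarrow> ('m, 'n, 'k) dpoly set
    \<Rightarrow> ('m, 'n, 'k) dpoly set \<Rightarrow> ('m, 'n, 'k) dpoly set
    \<Rightarrow> ('m, 'n, 'k::field_char_0) dpoly \<Rightarrow> ('m, 'n, 'k) rg_tuple"
  where "rg_update \<delta> lt G D A H p =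
    (let GA = {a\<in>A. \<exists>\<theta>. lead lt a = op_act \<theta> (lead lt p)};
         A' = A - GA
     in (G \<union> GA,
         (D \<union> {delta_poly \<delta> lt p a |a. a \<in> A'}) - {0},
         A' \<union> {p},
         H \<union> {sep lt p, init lt p}))"

text \<open>\<open>as\<close> lists the polynomials still to be treated; \<open>None\<close> signals the early exit.\<close>

fun pd_reduce_all ::
  "(('m, 'n) der \<Rightarrow> ('m, 'n) der \<Rightarrow> bool)
    \<Rightarrow> (('m, 'n, 'k::field_char_0) dpoly \<Rightarrow> ('m, 'n, 'k) dpoly set \<Rightarrow> ('m, 'n, 'k) dpoly)
    \<Rightarrow> ('m, 'n, 'k) dpoly set \<Rightarrow> ('m, 'n, 'k) dpoly list \<Rightarrow> ('m, 'n, 'k) dpoly set option"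
  where
  "pd_reduce_all lt pd_red B [] = Some B"
| "pd_reduce_all lt pd_red B (a # as) =
     (let b = pd_red a B in
      if b \<notin> ground \<and> rank lt b = rank lt a
      then pd_reduce_all lt pd_red (insert b B) as
      else None)"

definition by_increasing_leader ::
  "(('m, 'n) der \<Rightarrow> ('m, 'n) der \<Rightarrow> bool) \<Rightarrow> ('m, 'n, 'k::field_char_0) dpoly set
    \<Rightarrow> ('m, 'n, 'k) dpoly list"
  where "by_increasing_leader lt A =
    (THE as. set as = A \<and> sorted_wrt (\<lambda>a b. lt (lead lt a) (lead lt b)) as)"

definition auto_partial_reduce ::
  "(('m, 'n) der \<Rightarrow> ('m, 'n) der \<Rightarrow> bool)
    \<Rightarrow> (('m, 'n, 'k::field_char_0) dpoly \<Rightarrow> ('m, 'n, 'k) dpoly set \<Rightarrow> ('m, 'n, 'k) dpoly)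
    \<Rightarrow> ('m, 'n, 'k) dpoly set \<Rightarrow> ('m, 'n, 'k) dpoly set
    \<Rightarrow> (('m, 'n, 'k) dpoly set \<times> ('m, 'n, 'k) dpoly set) set"
  where "auto_partial_reduce lt pd_red A H =
    (case pd_reduce_all lt pd_red {} (by_increasing_leader lt A) of
       None \<Rightarrow> {}
     | Some B \<Rightarrow>
         (let K' = inits_seps lt B \<union> {pd_red q B |q. q \<in> H - inits_seps lt A}
          in if 0 \<in> K' then {} else {(B, K')}))"

text \<open>
  One iteration of the main loop on the pair of the set of pending tuples and the output set. The
  choice of the tuple and of \<open>p\<close> is left open.
\<close>

inductive rg_step ::
  "('m::finite \<Rightarrow> 'k \<Rightarrow> 'k) \<Rightarrow> (('m, 'n) der \<Rightarrow> ('m, 'n) der \<Rightarrow> bool)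
    \<Rightarrow> (('m, 'n, 'k::field_char_0) dpoly \<Rightarrow> ('m, 'n, 'k) dpoly set \<Rightarrow> ('m, 'n, 'k) dpoly)
    \<Rightarrow> (('m, 'n, 'k) dpoly \<Rightarrow> ('m, 'n, 'k) dpoly set \<Rightarrow> ('m, 'n, 'k) dpoly)
    \<Rightarrow> ('m, 'n, 'k) rg_tuple set \<times> (('m, 'n, 'k) dpoly set \<times> ('m, 'n, 'k) dpoly set) set
    \<Rightarrow> ('m, 'n, 'k) rg_tuple set \<times> (('m, 'n, 'k) dpoly set \<times> ('m, 'n, 'k) dpoly set) set
    \<Rightarrow> bool"
  for \<delta> lt d_red pd_red where
  finish:
    "(G, D, A, H) \<in> S \<Longrightarrow> G \<union> D = {} \<Longrightarrow>
     rg_step \<delta> lt d_red pd_red (S, Out)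
       (S - {(G, D, A, H)}, Out \<union> auto_partial_reduce lt pd_red A H)"
| vanish:
    "(G, D, A, H) \<in> S \<Longrightarrow> p \<in> G \<union> D \<Longrightarrow> d_red p A = 0 \<Longrightarrow>
     rg_step \<delta> lt d_red pd_red (S, Out)
       ((S - {(G, D, A, H)}) \<union> {(G - {p}, D - {p}, A, H)}, Out)"
| scalar:
    "(G, D, A, H) \<in> S \<Longrightarrow> p \<in> G \<union> D \<Longrightarrow> d_red p A \<in> ground - {0} \<Longrightarrow>
     rg_step \<delta> lt d_red pd_red (S, Out) (S - {(G, D, A, H)}, Out)"
| branch:
    "(G, D, A, H) \<in> S \<Longrightarrow> p \<in> G \<union> D \<Longrightarrow> q = d_red p A \<Longrightarrow> q \<notin> ground \<Longrightarrow>
     qi = q - init lt q * rank lt q \<Longrightarrow>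
     qs = of_nat (deg_in (lead lt q) q) * q - var (lead lt q) * sep lt q \<Longrightarrow>
     rg_step \<delta> lt d_red pd_red (S, Out)
       ((S - {(G, D, A, H)}) \<union>
        {rg_update \<delta> lt (G - {p}) (D - {p}) A H q,
         ((G - {p}) \<union> {qs, sep lt q}, D - {p}, A, H \<union> {init lt q}),
         ((G - {p}) \<union> {qi, init lt q}, D - {p}, A, H)}, Out)"

text \<open>\<open>\<A>\<close> is returned by a run of the algorithm on \<open>F\<close>, \<open>K\<close>.\<close>

definition rosenfeld_groebner ::
  "('m::finite \<Rightarrow> 'k \<Rightarrow> 'k) \<Rightarrow> (('m, 'n) der \<Rightarrow> ('m, 'n) der \<Rightarrow> bool)
    \<Rightarrow> (('m, 'n, 'k::field_char_0) dpoly \<Rightarrow> ('m, 'n, 'k) dpoly set \<Rightarrow> ('m, 'n, 'k) dpoly)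
    \<Rightarrow> (('m, 'n, 'k) dpoly \<Rightarrow> ('m, 'n, 'k) dpoly set \<Rightarrow> ('m, 'n, 'k) dpoly)
    \<Rightarrow> ('m, 'n, 'k) dpoly set \<Rightarrow> ('m, 'n, 'k) dpoly set
    \<Rightarrow> (('m, 'n, 'k) dpoly set \<times> ('m, 'n, 'k) dpoly set) set \<Rightarrow> bool"
  where "rosenfeld_groebner \<delta> lt d_red pd_red F K \<A> \<longleftrightarrow>
    (rg_step \<delta> lt d_red pd_red)\<^sup>*\<^sup>* ({(F, {}, {}, K)}, {}) ({}, \<A>)"


section \<open>Antichain sequences\<close>

definition der_le :: "('m \<Rightarrow> nat) \<times> 'n \<Rightarrow> ('m \<Rightarrow> nat) \<times> 'n \<Rightarrow> bool" where
  "der_le s t \<longleftrightarrow> snd s = snd t \<and> (\<forall>r. fst s r \<le> fst t r)"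

definition der_degree :: "('m::finite \<Rightarrow> nat) \<times> 'n \<Rightarrow> nat" where
  "der_degree s = (\<Sum>r\<in>UNIV. fst s r)"

definition antichain_seq :: "(('m \<Rightarrow> nat) \<times> 'n) list \<Rightarrow> bool" where
  "antichain_seq s \<longleftrightarrow>
     (\<forall>i<length s. \<forall>j<length s. i \<noteq> j \<longrightarrow> \<not> der_le (s ! i) (s ! j))"

text \<open>Sequences are indexed from 1, lists from 0.\<close>

definition degree_growth_bounded ::
  "(nat \<Rightarrow> nat) \<Rightarrow> (('m::finite \<Rightarrow> nat) \<times> 'n) list \<Rightarrow> bool" where
  "degree_growth_bounded f s \<longleftrightarrow> (\<forall>i<length s. der_degree (s ! i) \<le> f (i + 1))"

definition max_antichain_length :: "'m::finite itself \<Rightarrow> 'n::finite itself \<Rightarrow> (nat \<Rightarrow> nat) \<Rightarrow> nat"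
  where "max_antichain_length (_ :: 'm itself) (_ :: 'n itself) f =
    (GREATEST l. \<exists>s :: (('m \<Rightarrow> nat) \<times> 'n) list.
       antichain_seq s \<and> degree_growth_bounded f s \<and> length s = l)"

end

theory Submission
  imports Defs "HOL-Library.FuncSet" "HOL-Library.Infinite_Set"
begin

text \<open>
  For a weighted ranking the weight of a polynomial is the weight of its leader, and
  $w(\Delta(p, a)) \le w(\mathrm{lead}(p)) + w(\mathrm{lead}(a))$. Each tuple $(G, D, A, H)$ comes with
  an antichain sequence $s_1, \dots, s_k$ with $w(s_i) \le h f_i$ such that every $s_i$ is a
  derivative of a leader of $A$, all leaders of $A$ except possibly $s_k$ have weight at most
  $h f_{k-1}$, and the weights in $G \cup D \cup H$ are at most $h f_{k+1}$. When a polynomial with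
  leader $u$ enters $A$, the sequence is kept if $w(u) \le h f_{k-1}$; otherwise $u$ replaces $s_k$ if
  $s_k$ is a derivative of $u$, and is appended if not. In each case the new
  $\Delta$-polynomials obey the bound by the Fibonacci recursion. As degrees are at most weights,
  $k \le L$.
\<close>

section \<open>Differential polynomials\<close>

text \<open>Updating a fresh key amounts to adding a single term, and the zero map is a single term
  with coefficient 0. Additive and bilinear identities thus reduce to monomials.\<close>

lemma poly_mapping_single_induct [case_names single add]:
  fixes f :: "'a \<Rightarrow>\<^sub>0 'b::comm_monoid_add"
  assumes single: "\<And>\<mu> a. P (Poly_Mapping.single \<mu> a)"
    and add: "\<And>f g. P f \<Longrightarrow> P g \<Longrightarrow> P (f + g)"
  shows "P f"
proof (induction f rule: update_induct)
  case const
  then show ?case using single[of undefined 0] by simp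
next
  case (update f \<mu> a)
  have "Poly_Mapping.update \<mu> a f = f + Poly_Mapping.single \<mu> a"
    using update(1) by (intro poly_mapping_eqI)
      (auto simp: lookup_update lookup_add lookup_single when_def in_keys_iff)
  then show ?case using update(3) add single by simp
qed

lemma const_mult_var_power:
  "const a * var u ^ d = Poly_Mapping.single (Poly_Mapping.single u d) a"
proof (induction d)
  case (Suc d)
  have "const a * var u ^ Suc d = Poly_Mapping.single (Poly_Mapping.single u d) a * var u"
    by (simp add: Suc[symmetric] ac_simps)
  then show ?case
    by (simp add: var_def mult_single single_add[symmetric])
qed (simp add: const_def)

text \<open>The ring is generated by the ground field and the derivatives. This is used to check the
  commutation of derivations on generators.\<close>

lemma dpoly_induct [case_names const var add mult]:
  fixes f :: "('m, 'n, 'k::field_char_0) dpoly"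
  assumes const: "\<And>a. P (const a)"
    and var: "\<And>u. P (var u)"
    and add: "\<And>f g. P f \<Longrightarrow> P g \<Longrightarrow> P (f + g)"
    and mult: "\<And>f g. P f \<Longrightarrow> P g \<Longrightarrow> P (f * g)"
  shows "P f"
proof (induction f rule: poly_mapping_single_induct)
  case (single \<mu> a)
  have pow: "P (Poly_Mapping.single (Poly_Mapping.single u d) b)" for u d b
    unfolding const_mult_var_power[symmetric]
  proof (induction d)
    case (Suc d)
    then show ?case using mult[OF _ var, of "const b * var u ^ d" u] by (simp add: ac_simps)
  qed (simp add: const)
  \<comment> \<open>An exponent is itself a finitely supported map, so the same monomial induction
    applies to it; the first factor carries the coefficient.\<close>
  show ?case
  proof (induction \<mu> arbitrary: a rule: poly_mapping_single_induct)
    case (add \<mu> \<nu>)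
    show ?case using mult[OF add(1)[of a] add(2)[of 1]] by (simp add: mult_single)
  qed (rule pow)
qed (rule add)

section \<open>Formal partial derivatives\<close>

lemma partial_der_add: "partial_der u (f + g) = partial_der u f + partial_der u g"
  unfolding partial_der_def
  by (rule setsum_keys_plus_distrib) (simp_all add: single_add algebra_simps)

lemma partial_der_single:
  "partial_der u (Poly_Mapping.single \<mu> a) =
    Poly_Mapping.single (\<mu> - Poly_Mapping.single u 1) (of_nat (Poly_Mapping.lookup \<mu> u) * a)"
  by (cases "a = 0") (simp_all add: partial_der_def)

lemma partial_der_mult: "partial_der u (f * g) = partial_der u f * g + f * partial_der u g"
proof (induction f rule: poly_mapping_single_induct)
  case (single \<mu> a)
  show ?case
  proof (induction g rule: poly_mapping_single_induct)
    case (single \<nu> b)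
    \<comment> \<open>Subtraction of exponents is truncated, so the two exponents may differ when u
      does not occur in \<mu>; but then the coefficient is 0 on both sides.\<close>
    have shift: "Poly_Mapping.single (\<mu> + \<nu> - Poly_Mapping.single u 1) (of_nat (Poly_Mapping.lookup \<mu> u) * c)
      = Poly_Mapping.single (\<mu> - Poly_Mapping.single u 1 + \<nu>) (of_nat (Poly_Mapping.lookup \<mu> u) * c)"
      for \<mu> \<nu> :: "('a, 'b) der \<Rightarrow>\<^sub>0 nat" and c :: 'c
    proof (cases "Poly_Mapping.lookup \<mu> u = 0")
      case False
      then have "\<mu> + \<nu> - Poly_Mapping.single u 1 = \<mu> - Poly_Mapping.single u 1 + \<nu>"
        by (intro poly_mapping_eqI) (auto simp: lookup_add lookup_minus lookup_single when_def)
      then show ?thesis by simp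
    qed simp
    have "partial_der u (Poly_Mapping.single \<mu> a * Poly_Mapping.single \<nu> b) =
        Poly_Mapping.single (\<mu> + \<nu> - Poly_Mapping.single u 1) (of_nat (Poly_Mapping.lookup \<mu> u) * (a * b))
      + Poly_Mapping.single (\<nu> + \<mu> - Poly_Mapping.single u 1) (of_nat (Poly_Mapping.lookup \<nu> u) * (a * b))"
      by (simp add: mult_single partial_der_single lookup_add single_add[symmetric] algebra_simps)
    then show ?case
      unfolding shift by (simp add: mult_single partial_der_single algebra_simps)
  qed (simp add: partial_der_add algebra_simps)
qed (simp add: partial_der_add algebra_simps)

section \<open>Derivatives occurring in a polynomial\<close>

lemma finite_ders [simp]: "finite (ders f)"
  by (simp add: ders_def)

lemma ders_const [simp]: "ders (const a) = {}"
  by (auto simp: ders_def const_def)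

lemma ders_var [simp]: "ders (var u :: ('m, 'n, 'k::field_char_0) dpoly) = {u}"
  by (simp add: ders_def var_def)

lemma ders_single: "ders (Poly_Mapping.single \<mu> a) \<subseteq> Poly_Mapping.keys \<mu>"
  by (auto simp: ders_def)

lemma ders_add: "ders (f + g) \<subseteq> ders f \<union> ders g"
  unfolding ders_def using keys_add[of f g] by blast

lemma ders_uminus [simp]: "ders (- f) = ders f"
  by (simp add: ders_def in_keys_iff)

lemma ders_diff: "ders (f - g) \<subseteq> ders f \<union> ders g"
  using ders_add[of f "- g"] by simp

lemma ders_mult: "ders (f * g) \<subseteq> ders f \<union> ders g"
proof
  fix u assume "u \<in> ders (f * g)"
  then obtain \<mu> where "\<mu> \<in> Poly_Mapping.keys (f * g)" "u \<in> Poly_Mapping.keys \<mu>"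
    by (auto simp: ders_def)
  then obtain \<mu>1 \<mu>2 where "\<mu>1 \<in> Poly_Mapping.keys f" "\<mu>2 \<in> Poly_Mapping.keys g"
    "u \<in> Poly_Mapping.keys (\<mu>1 + \<mu>2)"
    using keys_mult[of f g] by blast
  then show "u \<in> ders f \<union> ders g"
    using keys_add[of \<mu>1 \<mu>2] by (auto simp: ders_def)
qed

lemma ders_sum: "ders (sum g I) \<subseteq> (\<Union>i\<in>I. ders (g i))"
proof (induction I rule: infinite_finite_induct)
  case (insert i I)
  then show ?case using ders_add[of "g i" "sum g I"] by auto
qed (simp_all add: ders_def)

lemma ders_power: "ders (f ^ n) \<subseteq> ders f"
proof (induction n)
  case 0
  then show ?case by (simp add: ders_def)
next
  case (Suc n)
  then show ?case using ders_mult[of f "f ^ n"] by auto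
qed

lemma ders_of_nat_mult: "ders (of_nat n * f) \<subseteq> ders f"
proof -
  have "ders (of_nat n :: ('a, 'b, 'c::field_char_0) dpoly) = {}"
    by (metis const_def ders_const single_of_nat)
  then show ?thesis using ders_mult[of "of_nat n" f] by auto
qed

lemma keys_monomial_diff: "Poly_Mapping.keys (\<mu> - \<nu>) \<subseteq> Poly_Mapping.keys (\<mu> :: 'a \<Rightarrow>\<^sub>0 nat)"
  by (auto simp: in_keys_iff lookup_minus)

lemma ders_coeff_in: "ders (coeff_in u d f) \<subseteq> ders f"
proof -
  have "ders (Poly_Mapping.single (\<mu> - Poly_Mapping.single u d) (Poly_Mapping.lookup f \<mu>)) \<subseteq> ders f"
    if "\<mu> \<in> Poly_Mapping.keys f" for \<mu>
    using that ders_single keys_monomial_diff by (fastforce simp: ders_def)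
  then show ?thesis
    unfolding coeff_in_def by (intro order.trans[OF ders_sum]) auto
qed

lemma ders_partial_der: "ders (partial_der u f) \<subseteq> ders f"
proof -
  have "ders (Poly_Mapping.single (\<mu> - Poly_Mapping.single u 1) a) \<subseteq> ders f"
    if "\<mu> \<in> Poly_Mapping.keys f" for \<mu> a
    using that ders_single keys_monomial_diff by (fastforce simp: ders_def)
  then show ?thesis
    unfolding partial_der_def by (intro order.trans[OF ders_sum]) auto
qed

lemma partial_der_eq_0: "u \<notin> ders f \<Longrightarrow> partial_der u f = 0"
  unfolding partial_der_def by (intro sum.neutral) (auto simp: ders_def in_keys_iff)

lemma ground_iff: "f \<in> ground \<longleftrightarrow> ders f = {}"
proof
  assume "ders f = {}"
  then have "Poly_Mapping.keys f \<subseteq> {0}" by (auto simp: ders_def)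
  then have "f = const (Poly_Mapping.lookup f 0)"
    unfolding const_def
    by (intro poly_mapping_eqI) (auto simp: lookup_single when_def in_keys_iff)
  then show "f \<in> ground" by (auto simp: ground_def)
qed (auto simp: ground_def)

text \<open>The terms for u outside \<open>ders f\<close> vanish. A common index set lets the values
  of \<open>dderiv\<close> on f, g and their sum or product be compared term by term.\<close>

lemma dderiv_eq_sum:
  assumes "finite U" "ders f \<subseteq> U"
  shows "dderiv \<delta> i f =
    Poly_Mapping.map (\<delta> i) f + (\<Sum>u\<in>U. partial_der u f * var (op_act (unit_op i) u))"
proof -
  have "(\<Sum>u\<in>ders f. partial_der u f * var (op_act (unit_op i) u)) =
    (\<Sum>u\<in>U. partial_der u f * var (op_act (unit_op i) u))"
    using assms by (intro sum.mono_neutral_left) (auto simp: partial_der_eq_0)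
  then show ?thesis by (simp add: dderiv_def)
qed

section \<open>The natural derivations: Leibniz rule and commutation\<close>

context differential_field
begin

lemma deriv_zero [simp]: "\<delta> i 0 = 0"
  using deriv_add[of i 0 0] by simp

text \<open>\<open>Poly_Mapping.map\<close> leaves zero coefficients alone, which agrees with
  applying the derivation because it maps 0 to 0.\<close>

lemma lookup_map_deriv: "Poly_Mapping.lookup (Poly_Mapping.map (\<delta> i) f) \<mu> = \<delta> i (Poly_Mapping.lookup f \<mu>)"
  by (simp add: map.rep_eq when_def)

lemma map_deriv_add:
  "Poly_Mapping.map (\<delta> i) (f + g) = Poly_Mapping.map (\<delta> i) f + Poly_Mapping.map (\<delta> i) g"
  by (intro poly_mapping_eqI) (simp add: lookup_map_deriv lookup_add deriv_add)

lemma map_deriv_mult: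
  fixes f g :: "('a::comm_monoid_add) \<Rightarrow>\<^sub>0 'k"
  shows "Poly_Mapping.map (\<delta> i) (f * g) = Poly_Mapping.map (\<delta> i) f * g + f * Poly_Mapping.map (\<delta> i) g"
proof (induction f rule: poly_mapping_single_induct)
  case (single \<mu> a)
  show ?case
  proof (induction g rule: poly_mapping_single_induct)
    case (single \<nu> b)
    then show ?case by (simp add: mult_single deriv_mult single_add)
  qed (simp add: map_deriv_add algebra_simps)
qed (simp add: map_deriv_add algebra_simps)

lemma dderiv_add: "dderiv \<delta> i (f + g) = dderiv \<delta> i f + dderiv \<delta> i g"
  using ders_add[of f g] dderiv_eq_sum[of "ders f \<union> ders g" _ \<delta> i]
  by (simp add: map_deriv_add partial_der_add algebra_simps sum.distrib)

lemma dderiv_mult: "dderiv \<delta> i (f * g) = dderiv \<delta> i f * g + f * dderiv \<delta> i g"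
  using ders_mult[of f g] dderiv_eq_sum[of "ders f \<union> ders g" _ \<delta> i]
  by (simp add: map_deriv_mult partial_der_mult algebra_simps sum.distrib sum_distrib_left)

lemma dderiv_const: "dderiv \<delta> i (const a) = const (\<delta> i a)"
  by (simp add: dderiv_def) (simp add: const_def)

lemma dderiv_var: "dderiv \<delta> i (var u) = var (op_act (unit_op i) u)"
proof -
  have "\<delta> i 1 = 0" using deriv_mult[of i 1 1] by simp
  then show ?thesis
    by (simp add: dderiv_def) (simp add: var_def partial_der_single mult_single)
qed

text \<open>The mixed terms of the Leibniz rule are symmetric in i and j, so agreement on constants
  and derivatives passes to products.\<close>

lemma dderiv_commute:
  fixes f :: "('m, 'n, 'k) dpoly"
  shows "dderiv \<delta> i (dderiv \<delta> j f) = dderiv \<delta> j (dderiv \<delta> i f)"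
proof (induction f rule: dpoly_induct)
  case (const a)
  then show ?case by (simp add: dderiv_const deriv_commute)
next
  case (var u)
  then show ?case by (simp add: dderiv_var op_act_def add_ac)
qed (simp_all add: dderiv_add dderiv_mult algebra_simps)

text \<open>This makes the fold in \<open>dop\<close> independent of the order, so that it can be
  unfolded one derivation at a time.\<close>

lemma comp_fun_commute_dderiv_power:
  "comp_fun_commute (\<lambda>i. (dderiv \<delta> i :: ('m, 'n, 'k) dpoly \<Rightarrow> ('m, 'n, 'k) dpoly) ^^ \<theta> i)"
proof -
  interpret comp_fun_commute "\<lambda>i. dderiv \<delta> i :: ('m, 'n, 'k) dpoly \<Rightarrow> ('m, 'n, 'k) dpoly"
    by unfold_locales (auto simp: fun_eq_iff dderiv_commute)
  show ?thesis by (rule comp_fun_commute_funpow)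
qed

end

section \<open>Weights and leaders\<close>

lemma weight_le_iff: "weight c f \<le> N \<longleftrightarrow> (\<forall>u\<in>ders f. wt c u \<le> N)"
  by (simp add: weight_def)

lemma wt_le_weight: "u \<in> ders f \<Longrightarrow> wt c u \<le> weight c f"
  by (simp add: weight_def)

lemma weight_mono: "ders f \<subseteq> ders g \<Longrightarrow> weight c f \<le> weight c g"
  by (auto simp: weight_le_iff intro: wt_le_weight)

lemma weight_diff: "weight c (f - g) \<le> max (weight c f) (weight c g)"
proof -
  have "wt c u \<le> max (weight c f) (weight c g)" if "u \<in> ders (f - g)" for u
    using that ders_diff[of f g] wt_le_weight[of u f c] wt_le_weight[of u g c]
    by (auto simp: le_max_iff_disj)
  then show ?thesis by (simp add: weight_le_iff)
qed

lemma weight_mult: "weight c (f * g) \<le> max (weight c f) (weight c g)"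
proof -
  have "wt c u \<le> max (weight c f) (weight c g)" if "u \<in> ders (f * g)" for u
    using that ders_mult[of f g] wt_le_weight[of u f c] wt_le_weight[of u g c]
    by (auto simp: le_max_iff_disj)
  then show ?thesis by (simp add: weight_le_iff)
qed

lemma weight_coeff_in: "weight c (coeff_in u d f) \<le> weight c f"
  by (rule weight_mono[OF ders_coeff_in])

lemma weight_partial_der: "weight c (partial_der u f) \<le> weight c f"
  by (rule weight_mono[OF ders_partial_der])

lemma weight_init: "weight c (init lt f) \<le> weight c f"
  by (simp add: init_def weight_coeff_in)

lemma weight_sep: "weight c (sep lt f) \<le> weight c f"
  by (simp add: sep_def weight_partial_der)

lemma weight_le_max_weight: "finite A \<Longrightarrow> f \<in> A \<Longrightarrow> weight c f \<le> max_weight c A"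
  by (simp add: max_weight_def)

text \<open>The set A may be infinite: bounded naturals form a finite set, so \<open>Max\<close> is
  still a true maximum.\<close>

lemma max_weight_le:
  assumes "\<And>f. f \<in> A \<Longrightarrow> weight c f \<le> N"
  shows "max_weight c A \<le> N"
proof -
  have "weight c ` A \<subseteq> {..N}" using assms by auto
  then have "finite (weight c ` A)" by (rule finite_subset) simp
  then show ?thesis using assms by (auto simp: max_weight_def)
qed

lemma wt_op_act: "wt c (op_act \<theta> u) = (\<Sum>i\<in>UNIV. c i * \<theta> i) + wt c u"
  by (simp add: wt_def op_act_def algebra_simps sum.distrib)

text \<open>Differentiating coefficients creates no derivatives, and the chain rule only adds the
  shifted ones, each heavier by \<open>c i\<close> than a derivative of f.\<close>

lemma (in differential_field) weight_dderiv: "weight c (dderiv \<delta> i f) \<le> c i + weight c f"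
proof -
  have "(\<Sum>j\<in>UNIV. c j * unit_op i j) = c i"
    by (simp add: unit_op_def if_distrib cong: if_cong)
  then have shift: "wt c (op_act (unit_op i) u) = c i + wt c u" for u :: "('m, 'n) der"
    by (simp add: wt_op_act)
  have "\<mu> \<in> Poly_Mapping.keys f" if "\<mu> \<in> Poly_Mapping.keys (Poly_Mapping.map (\<delta> i) f)" for \<mu>
    using that by (cases "Poly_Mapping.lookup f \<mu> = 0") (simp_all add: in_keys_iff lookup_map_deriv)
  then have map: "ders (Poly_Mapping.map (\<delta> i) f) \<subseteq> ders f"
    by (auto simp: ders_def)
  have "ders (partial_der u f * var (op_act (unit_op i) u)) \<subseteq> insert (op_act (unit_op i) u) (ders f)" for u
    using ders_mult[of "partial_der u f" "var (op_act (unit_op i) u)"] ders_partial_der[of u f] by auto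
  then have "ders (dderiv \<delta> i f) \<subseteq> ders f \<union> op_act (unit_op i) ` ders f"
    unfolding dderiv_def
    by (intro order.trans[OF ders_add] Un_least order.trans[OF map] order.trans[OF ders_sum]) auto
  then show ?thesis
    by (fastforce simp: weight_le_iff shift dest: wt_le_weight[of _ f c])
qed

lemma (in differential_field) weight_dop:
  fixes f :: "('m, 'n, 'k) dpoly"
  shows "weight c (dop \<delta> \<theta> f) \<le> (\<Sum>i\<in>UNIV. c i * \<theta> i) + weight c f"
proof -
  interpret comp_fun_commute "\<lambda>i. (dderiv \<delta> i :: ('m, 'n, 'k) dpoly \<Rightarrow> ('m, 'n, 'k) dpoly) ^^ \<theta> i"
    by (rule comp_fun_commute_dderiv_power)
  have pow: "weight c ((dderiv \<delta> i ^^ d) g) \<le> c i * d + weight c g" for i d and g :: "('m, 'n, 'k) dpoly"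
  proof (induction d)
    case (Suc d)
    then show ?case
      using weight_dderiv[of c i "(dderiv \<delta> i ^^ d) g"] by simp
  qed simp
  \<comment> \<open>The fold over \<open>UNIV\<close> is generalised to a fold over any finite I,
    which allows induction on I.\<close>
  have "weight c (Finite_Set.fold (\<lambda>i. dderiv \<delta> i ^^ \<theta> i) f I) \<le> (\<Sum>i\<in>I. c i * \<theta> i) + weight c f"
    if "finite I" for I
    using that
  proof (induction I rule: finite_induct)
    case (insert i I)
    then show ?case
      using pow[of "\<theta> i" i "Finite_Set.fold (\<lambda>i. dderiv \<delta> i ^^ \<theta> i) f I"] by simp
  qed simp
  then show ?thesis by (simp add: dop_def)
qed

section \<open>Leaders under a weighted ranking\<close>

locale weighted_ranking_field = differential_field \<delta>
  for \<delta> :: "'m::finite \<Rightarrow> 'k::field_char_0 \<Rightarrow> 'k" +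
  fixes c :: "'m \<Rightarrow> nat" and lt :: "('m, 'n::finite) der \<Rightarrow> ('m, 'n) der \<Rightarrow> bool"
  assumes pos: "\<And>i. 0 < c i"
    and weighted: "weighted_ranking c lt"
begin

lemma strict_total: "irreflp lt" "transp lt" "totalp lt"
  using weighted unfolding weighted_ranking_def ranking_def by blast+

lemma lt_irrefl: "\<not> lt u u"
  using strict_total(1) by (rule irreflpD)

lemma lt_trans: "lt u v \<Longrightarrow> lt v w \<Longrightarrow> lt u w"
  using strict_total(2) by (rule transpD)

lemma lt_total: "lt u v \<or> u = v \<or> lt v u"
  using strict_total(3) by (auto dest: totalpD)

text \<open>Otherwise v would be strictly lighter than u, hence ranked below u, against
  asymmetry.\<close>

lemma lt_imp_wt_le: "lt u v \<Longrightarrow> wt c u \<le> wt c v"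
  using weighted lt_irrefl lt_trans unfolding weighted_ranking_def by (meson leI)

lemma ex_lt_greatest:
  "finite U \<Longrightarrow> U \<noteq> {} \<Longrightarrow> \<exists>u\<in>U. \<forall>v\<in>U. v \<noteq> u \<longrightarrow> lt v u"
proof (induction U rule: finite_ne_induct)
  case (insert x U)
  then obtain u where "u \<in> U" "\<And>v. v \<in> U \<Longrightarrow> v \<noteq> u \<Longrightarrow> lt v u" by blast
  then show ?case using lt_total[of x u] lt_trans by blast
qed simp

text \<open>This justifies the \<open>THE\<close> in \<open>lead\<close>: a finite nonempty set has
  a greatest element for a strict total order, and asymmetry makes it unique.\<close>

lemma lead_greatest:
  assumes "f \<notin> ground"
  shows "lead lt f \<in> ders f \<and> (\<forall>v\<in>ders f. v \<noteq> lead lt f \<longrightarrow> lt v (lead lt f))"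
proof -
  have "ders f \<noteq> {}" using assms by (simp add: ground_iff)
  from ex_lt_greatest[OF finite_ders this]
  obtain u where u: "u \<in> ders f \<and> (\<forall>v\<in>ders f. v \<noteq> u \<longrightarrow> lt v u)" by (elim bexE) simp
  then show ?thesis
    unfolding lead_def
  proof (rule theI)
    fix v assume "v \<in> ders f \<and> (\<forall>w\<in>ders f. w \<noteq> v \<longrightarrow> lt w v)"
    then show "v = u" using u lt_irrefl lt_trans by metis
  qed
qed

text \<open>Every other derivative in f ranks below the leader and so is no heavier.\<close>

lemma weight_eq_wt_lead:
  assumes "f \<notin> ground"
  shows "weight c f = wt c (lead lt f)"
proof (rule antisym)
  show "weight c f \<le> wt c (lead lt f)"
    unfolding weight_le_iff using lead_greatest[OF assms] lt_imp_wt_le by (metis order_refl)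
qed (simp add: lead_greatest[OF assms] wt_le_weight)

lemma lead_var [simp]: "lead lt (var u :: ('m, 'n, 'k) dpoly) = u"
  unfolding lead_def by (rule the_equality) auto

lemma var_notin_ground [simp]: "var u \<notin> ground"
  by (simp add: ground_iff)

lemma var_eq_iff [simp]: "(var u :: ('m, 'n, 'k) dpoly) = var v \<longleftrightarrow> u = v"
  by (metis lead_var)

lemma deg_in_pos: "u \<in> ders f \<Longrightarrow> 0 < deg_in u f"
  by (auto simp: ders_def deg_in_def Max_gr_iff in_keys_iff intro!: bexI)

lemma deg_in_var: "deg_in v (var u :: ('m, 'n, 'k) dpoly) = (if u = v then 1 else 0)"
  by (simp add: deg_in_def var_def lookup_single when_def)

text \<open>A rank is a monomial $u^d$ with d > 0, because the leader occurs in the polynomial;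
  hence u can be read off as the only key of the exponent.\<close>

lemma lead_eq_if_rank_eq:
  fixes f g :: "('m, 'n, 'k) dpoly"
  assumes "f \<notin> ground" "g \<notin> ground" "rank lt f = rank lt g"
  shows "lead lt f = lead lt g"
proof -
  have *: "rank lt f = Poly_Mapping.single (Poly_Mapping.single (lead lt f) (deg_in (lead lt f) f)) 1"
    "0 < deg_in (lead lt f) f" if "f \<notin> ground" for f :: "('m, 'n, 'k) dpoly"
    using const_mult_var_power[of "1::'k" "lead lt f"] lead_greatest[OF that]
      deg_in_pos[of "lead lt f" f]
    by (simp_all add: rank_def const_def)
  have "Poly_Mapping.keys (rank lt f) = Poly_Mapping.keys (rank lt g)" using assms by simp
  then have "Poly_Mapping.single (lead lt f) (deg_in (lead lt f) f) =
    Poly_Mapping.single (lead lt g) (deg_in (lead lt g) g)"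
    using * assms(1,2) by simp
  then have "Poly_Mapping.keys (Poly_Mapping.single (lead lt f) (deg_in (lead lt f) f)) =
    Poly_Mapping.keys (Poly_Mapping.single (lead lt g) (deg_in (lead lt g) g))" by simp
  then show ?thesis using *(2)[OF assms(1)] *(2)[OF assms(2)] by simp
qed

text \<open>This turns the specification of the reductions, which speaks of ranks, into a bound on
  weights.\<close>

lemma weight_le_if_rank_not_above:
  assumes "rank_not_above lt f g"
  shows "weight c f \<le> weight c g"
proof (cases "f \<in> ground")
  case True
  then show ?thesis by (simp add: ground_iff weight_le_iff)
next
  case False
  then show ?thesis
    using assms lt_imp_wt_le[of "lead lt f" "lead lt g"]
    by (auto simp: rank_not_above_def weight_eq_wt_lead)
qed

end

section \<open>Antichain sequences\<close>

lemma der_le_refl [simp]: "der_le u u"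
  by (simp add: der_le_def)

lemma der_le_trans: "der_le u v \<Longrightarrow> der_le v w \<Longrightarrow> der_le u w"
  using order_trans by (fastforce simp: der_le_def)

text \<open>The witness is the coordinatewise difference of exponents. The lemma links the test in
  \<open>rg_update\<close> to the order used for antichains.\<close>

lemma ex_op_act_iff: "(\<exists>\<theta>. v = op_act \<theta> u) \<longleftrightarrow> der_le u v"
proof
  assume "der_le u v"
  then have "v = op_act (\<lambda>i. fst v i - fst u i) u"
    by (auto simp: der_le_def op_act_def prod_eq_iff fun_eq_iff)
  then show "\<exists>\<theta>. v = op_act \<theta> u" by blast
qed (auto simp: der_le_def op_act_def)

lemma der_le_imp_wt_le: "der_le u v \<Longrightarrow> wt c u \<le> wt c v"
  by (auto simp: der_le_def wt_def intro!: sum_mono)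

lemma antichain_seq_snoc:
  "antichain_seq (s @ [u]) \<longleftrightarrow>
    antichain_seq s \<and> (\<forall>x\<in>set s. \<not> der_le x u \<and> \<not> der_le u x)"
  unfolding antichain_seq_def
  by (auto simp: nth_append less_Suc_eq all_conj_distrib all_set_conv_all_nth)

lemma antichain_seq_append: "antichain_seq (s @ t) \<Longrightarrow> antichain_seq s"
  by (induction t rule: rev_induct) (auto simp: antichain_seq_snoc simp flip: append_assoc)

lemma degree_growth_bounded_append:
  "degree_growth_bounded f (s @ t) \<Longrightarrow> degree_growth_bounded f s"
  unfolding degree_growth_bounded_def
  by (metis length_append nth_append trans_less_add1)

section \<open>Dickson's lemma\<close>

lemma mono_subseq_nat:
  fixes f :: "nat \<Rightarrow> nat"
  obtains r where "strict_mono r" "incseq (\<lambda>i. f (r i))"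
proof -
  obtain r where r: "strict_mono r" "monoseq (\<lambda>i. f (r i))"
    using seq_monosub[of f] by blast
  show ?thesis
  proof (cases "decseq (\<lambda>i. f (r i))")
    case True
    \<comment> \<open>A decreasing sequence of naturals is constant from the index N where it
      attains its least value v; dropping the earlier terms makes it increasing in the weak
      sense.\<close>
    define v where "v = (LEAST v. v \<in> range (\<lambda>i. f (r i)))"
    have "v \<in> range (\<lambda>i. f (r i))" unfolding v_def by (rule LeastI) auto
    then obtain N where N: "v = f (r N)" by auto
    have least: "v \<le> f (r j)" for j unfolding v_def by (rule Least_le) simp
    have "f (r (i + N)) = v" for i
      using True least by (intro antisym) (auto simp: N decseq_def)
    moreover have "strict_mono (\<lambda>i. r (i + N))" using r(1) by (simp add: strict_mono_def)
    ultimately show ?thesis by (intro that[of "\<lambda>i. r (i + N)"]) auto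
  next
    case False
    then show ?thesis using r that by (auto simp: monoseq_iff)
  qed
qed

text \<open>Subsequences are taken once per coordinate; passing to a further subsequence keeps the
  coordinates already treated monotone.\<close>

lemma mono_subseq_family:
  fixes f :: "nat \<Rightarrow> 'm::finite \<Rightarrow> nat"
  shows "\<exists>r. strict_mono r \<and> (\<forall>x. incseq (\<lambda>i. f (r i) x))"
proof -
  have "\<exists>r. strict_mono r \<and> (\<forall>x\<in>X. incseq (\<lambda>i. f (r i) x))" if "finite X" for X
    using that
  proof (induction X rule: finite_induct)
    case empty
    then show ?case using strict_mono_id by blast
  next
    case (insert x X)
    then obtain r where r: "strict_mono r" "\<And>y. y \<in> X \<Longrightarrow> incseq (\<lambda>i. f (r i) y)" by blast
    obtain q where q: "strict_mono q" "incseq (\<lambda>i. f (r (q i)) x)"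
      using mono_subseq_nat[of "\<lambda>i. f (r i) x"] by blast
    have "strict_mono (r \<circ> q)" using r q by (simp add: strict_mono_o)
    moreover have "incseq (\<lambda>i. f (r (q i)) y)" if "y \<in> X" for y
      using r(2)[OF that] q(1) by (simp add: mono_def strict_mono_less_eq)
    ultimately show ?case using q(2) by (intro exI[of _ "r \<circ> q"]) (auto simp: o_def)
  qed
  from this[of UNIV] show ?thesis by simp
qed

text \<open>By pigeonhole one indeterminate occurs infinitely often; in a subsequence there that is
  monotone in all coordinates, the first two terms are comparable.\<close>

lemma ex_der_le_pair:
  fixes s :: "nat \<Rightarrow> ('m::finite \<Rightarrow> nat) \<times> 'n::finite"
  shows "\<exists>i j. i < j \<and> der_le (s i) (s j)"
proof -
  obtain k where "infinite {i. snd (s i) = snd (s k)}"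
    using pigeonhole_infinite[of UNIV "\<lambda>i. snd (s i)"] by auto
  from infinite_enumerate[OF this] obtain e :: "nat \<Rightarrow> nat"
    where e: "strict_mono e" "\<And>i. snd (s (e i)) = snd (s k)"
    by auto
  obtain r where r: "strict_mono r" "\<And>x. incseq (\<lambda>i. fst (s (e (r i))) x)"
    using mono_subseq_family[of "\<lambda>i. fst (s (e i))"] by auto
  have "e (r 0) < e (r 1)" using e(1) r(1) by (simp add: strict_mono_less)
  moreover have "der_le (s (e (r 0))) (s (e (r 1)))"
    using r(2) by (simp add: der_le_def e(2) incseq_def)
  ultimately show ?thesis by blast
qed

lemma finite_der_degree_le:
  "finite {x :: ('m::finite \<Rightarrow> nat) \<times> 'n::finite. der_degree x \<le> d}"
proof (rule finite_subset)
  show "{x :: ('m \<Rightarrow> nat) \<times> 'n. der_degree x \<le> d} \<subseteq> (UNIV \<rightarrow>\<^sub>E {..d}) \<times> UNIV"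
  proof (clarsimp simp: PiE_def Pi_def der_degree_def)
    fix g :: "'m \<Rightarrow> nat" and r
    assume "sum g UNIV \<le> d"
    then show "g r \<le> d" using member_le_sum[of r UNIV g] by simp
  qed
  show "finite ((UNIV \<rightarrow>\<^sub>E {..d}) \<times> UNIV :: (('m \<Rightarrow> nat) \<times> 'n) set)"
    by (intro finite_cartesian_product finite_PiE) auto
qed

text \<open>
  Extending an antichain by one element is well-founded (Dickson's lemma) and finitely branching
  (bounded degrees); the bound comes from the argument of Koenig's lemma.
\<close>

lemma antichain_seq_length_bounded:
  fixes f :: "nat \<Rightarrow> nat"
  shows "\<exists>N. \<forall>s :: (('m::finite \<Rightarrow> nat) \<times> 'n::finite) list.
    antichain_seq s \<and> degree_growth_bounded f s \<longrightarrow> length s \<le> N"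
proof -
  define ok where "ok s \<longleftrightarrow> antichain_seq s \<and> degree_growth_bounded f s"
    for s :: "(('m \<Rightarrow> nat) \<times> 'n) list"
  \<comment> \<open>The extension stands on the left, so well-founded induction on \<open>R\<close>
    derives the claim for s from its one-element extensions.\<close>
  define R where "R = {(s @ [x], s) |s x. ok (s @ [x])}"
  have ok_prefix: "ok s" if "ok (s @ t)" for s t
    using that antichain_seq_append degree_growth_bounded_append by (auto simp: ok_def)
  have "wf R"
  proof (rule ccontr)
    assume "\<not> wf R"
    then obtain S where S: "\<And>i. (S (Suc i), S i) \<in> R"
      by (auto simp: wf_iff_no_infinite_down_chain)
    have "\<exists>x. S (Suc i) = S i @ [x] \<and> ok (S i @ [x])" for i
      using S[of i] by (auto simp: R_def)
    then obtain x where x: "\<And>i. S (Suc i) = S i @ [x i]" and ok: "\<And>i. ok (S i @ [x i])"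
      by metis
    \<comment> \<open>An infinite chain appends x 0, x 1, and so on. Each x j joins a list
      containing all earlier terms, so a comparable pair contradicts the antichain property.\<close>
    have in_set: "x i \<in> set (S j)" if "i < j" for i j
      using that by (induction j) (auto simp: x less_Suc_eq)
    obtain i j where "i < j" "der_le (x i) (x j)" using ex_der_le_pair[of x] by blast
    then show False
      using ok[of j] in_set[of i j] by (auto simp: ok_def x antichain_seq_snoc)
  qed
  then have "\<exists>N. \<forall>t. ok (s @ t) \<longrightarrow> length t \<le> N" for s
  proof (induction s rule: wf_induct_rule)
    case (less s)
    define X where "X = {x. ok (s @ [x])}"
    have "\<exists>N. \<forall>t. ok ((s @ [x]) @ t) \<longrightarrow> length t \<le> N" if "x \<in> X" for x
      by (rule less) (use that in \<open>simp add: R_def X_def del: split_paired_Ex\<close>)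
    then obtain N where N: "\<And>x t. x \<in> X \<Longrightarrow> ok ((s @ [x]) @ t) \<Longrightarrow> length t \<le> N x" by metis
    have "X \<subseteq> {x. der_degree x \<le> f (Suc (length s))}"
      by (auto simp: X_def ok_def degree_growth_bounded_def nth_append)
    then have "finite X" using finite_der_degree_le finite_subset by blast
    \<comment> \<open>One for the first appended element, plus the largest bound among its finitely
      many choices; the inserted 0 covers the case of no choice.\<close>
    have "length t \<le> Suc (Max (insert 0 (N ` X)))" if t: "ok (s @ t)" for t
    proof (cases t)
      case (Cons x t')
      then have "x \<in> X" using ok_prefix[of "s @ [x]" t'] t by (simp add: X_def)
      moreover have "length t' \<le> N x" using N[OF \<open>x \<in> X\<close>] t Cons by simp
      ultimately have "length t' \<le> Max (insert 0 (N ` X))"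
        using \<open>finite X\<close> by (auto simp: Max_ge_iff)
      then show ?thesis using Cons by simp
    qed simp
    then show ?case by blast
  qed
  from this[of "[]"] show ?thesis by (auto simp: ok_def)
qed

text \<open>\<open>GREATEST\<close> is meaningful only for a bounded set of lengths, which the
  preceding lemma provides.\<close>

lemma length_le_max_antichain_length:
  fixes s :: "(('m::finite \<Rightarrow> nat) \<times> 'n::finite) list"
  assumes "antichain_seq s" "degree_growth_bounded f s"
  shows "length s \<le> max_antichain_length TYPE('m) TYPE('n) f"
proof -
  obtain N where "\<And>s :: (('m \<Rightarrow> nat) \<times> 'n) list.
    antichain_seq s \<Longrightarrow> degree_growth_bounded f s \<Longrightarrow> length s \<le> N"
    using antichain_seq_length_bounded by blast
  then show ?thesis
    unfolding max_antichain_length_def using assms by (intro Greatest_le_nat) auto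
qed

section \<open>Tracking the leaders by an antichain sequence\<close>

text \<open>For \<open>s = []\<close> the truncated \<open>length s - Suc 0\<close> gives the bound $h f_0 = 0$.\<close>

definition tracks ::
  "('m::finite \<Rightarrow> nat) \<Rightarrow> nat \<Rightarrow> ('m, 'n) der set \<Rightarrow> ('m, 'n) der list \<Rightarrow> bool" where
  "tracks c h U s \<longleftrightarrow> antichain_seq s \<and>
    (\<forall>i<length s. wt c (s ! i) \<le> h * fib (Suc i)) \<and>
    (\<forall>x\<in>set s. \<exists>u\<in>U. der_le u x) \<and>
    (\<forall>u\<in>U. wt c u \<le> h * fib (length s - Suc 0) \<or> s \<noteq> [] \<and> u = last s)"

text \<open>The exceptional leader \<open>last s\<close> has list index \<open>length s - 1\<close>,
  hence is term number \<open>length s\<close> and obeys the Fibonacci bound of that number.\<close>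

lemma tracks_imp_wt_le:
  assumes "tracks c h U s" "u \<in> U"
  shows "wt c u \<le> h * fib (length s)"
proof -
  have "wt c (last s) \<le> h * fib (length s)" if "s \<noteq> []"
  proof -
    have "length s - Suc 0 < length s" using that by simp
    then have "wt c (s ! (length s - Suc 0)) \<le> h * fib (Suc (length s - Suc 0))"
      using assms(1) unfolding tracks_def by blast
    then show ?thesis using that by (simp add: last_conv_nth)
  qed
  moreover have "h * fib (length s - Suc 0) \<le> h * fib (length s)" by (simp add: fib_mono)
  ultimately show ?thesis using assms order_trans unfolding tracks_def by blast
qed

text \<open>This is the recursion, weakened to an inequality for n = 0, where truncation gives 0 + 0
  on the left and 1 on the right.\<close>

lemma fib_pred_add: "fib (n - Suc 0) + fib n \<le> fib (Suc n)"
  by (cases n) simp_all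

text \<open>Here U holds the leaders of A, u is the leader entering, and the derivatives of u leave.
  The assumption \<open>minimal\<close> comes from reducedness with respect to A; the last
  conclusion bounds the new \<Delta>-polynomials.\<close>

lemma tracks_insert:
  fixes U :: "('m::finite, 'n) der set"
  assumes s: "tracks c h U s"
    and u: "wt c u \<le> h * fib (Suc (length s))"
    and minimal: "\<And>v. v \<in> U \<Longrightarrow> der_le v u \<Longrightarrow> v = u"
  obtains t where "length s \<le> length t" "tracks c h (insert u {v\<in>U. \<not> der_le u v}) t"
    "\<And>v. v \<in> U \<Longrightarrow> \<not> der_le u v \<Longrightarrow> wt c u + wt c v \<le> h * fib (Suc (length t))"
proof -
  define k where "k = length s"
  let ?U = "insert u {v\<in>U. \<not> der_le u v}"
  have anti: "antichain_seq s"
    and wt_s: "\<And>i. i < k \<Longrightarrow> wt c (s ! i) \<le> h * fib (Suc i)"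
    and above: "\<And>x. x \<in> set s \<Longrightarrow> \<exists>v\<in>U. der_le v x"
    and wt_U: "\<And>v. v \<in> U \<Longrightarrow> wt c v \<le> h * fib (k - Suc 0) \<or> s \<noteq> [] \<and> v = last s"
    using s by (simp_all add: tracks_def k_def)
  have fib_pred: "h * fib (k - Suc 0) + h * fib k \<le> h * fib (Suc k)"
    using fib_pred_add[of k] by (simp flip: distrib_left)
  have wt_last: "wt c (last s) \<le> h * fib k" if "s \<noteq> []"
    using wt_s[of "k - Suc 0"] that by (simp add: last_conv_nth k_def)
  have wt_U_le: "wt c v \<le> h * fib k" if "v \<in> U" for v
    using tracks_imp_wt_le[OF s that] by (simp add: k_def)
  have wt_butlast: "wt c x \<le> h * fib (k - Suc 0)" if x: "x \<in> set (butlast s)" for x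
  proof -
    obtain i where i: "i < k - Suc 0" "x = s ! i"
      using x by (auto simp: in_set_conv_nth k_def nth_butlast)
    then have "wt c x \<le> h * fib (Suc i)" using wt_s[of i] by simp
    also have "\<dots> \<le> h * fib (k - Suc 0)" using i by (intro mult_le_mono fib_mono) auto
    finally show ?thesis .
  qed
  \<comment> \<open>If the leader below x is removed, it is a derivative of u, so u takes its place
    below x.\<close>
  have above': "\<exists>v\<in>?U. der_le v x" if "x \<in> set s" for x
    using above[OF that] der_le_trans by blast
  \<comment> \<open>Some v in U lies below x. If x were below u, minimality would give v = u, and
    then u would lie below x.\<close>
  have incomparable: "\<not> der_le x u" if x: "x \<in> set s" "\<not> der_le u x" for x
  proof
    assume "der_le x u"
    moreover obtain v where "v \<in> U" "der_le v x" using above[OF x(1)] by blast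
    ultimately show False using minimal[of v] der_le_trans[of v x u] x(2) by auto
  qed
  \<comment> \<open>All terms before the last weigh at most h * fib (k - 1). If u is heavier, only
    the last term can be a derivative of u.\<close>
  consider (low) "wt c u \<le> h * fib (k - Suc 0)"
    | (replace) "h * fib (k - Suc 0) < wt c u" "s \<noteq> []" "der_le u (last s)"
    | (extend) "h * fib (k - Suc 0) < wt c u" "\<And>x. x \<in> set s \<Longrightarrow> \<not> der_le u x"
  proof (cases "wt c u \<le> h * fib (k - Suc 0)")
    case False
    have "x = last s" if "x \<in> set s" "der_le u x" for x
    proof (rule ccontr)
      assume "x \<noteq> last s"
      then have "x \<in> set (butlast s)"
        using that(1) by (cases s rule: rev_cases) auto
      then show False using wt_butlast der_le_imp_wt_le[OF that(2), of c] False by fastforce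
    qed
    then show ?thesis using that(2,3) False by (metis empty_iff empty_set not_le)
  qed
  then show ?thesis
  proof cases
    case low
    show ?thesis
    proof (rule that[of s])
      show "tracks c h ?U s"
        using anti wt_s above' wt_U low by (auto simp: tracks_def k_def)
      \<comment> \<open>A leader v may weigh as much as h * fib k, but u then contributes at most h
        * fib (k - 1).\<close>
      show "wt c u + wt c v \<le> h * fib (Suc (length s))" if "v \<in> U" for v
        using low wt_U_le[OF that] fib_pred by (simp add: k_def)
    qed simp
  next
    case replace
    have len: "Suc (length (butlast s)) = k" using replace(2) by (simp add: k_def)
    have wt_u: "wt c u \<le> h * fib k"
      using der_le_imp_wt_le[OF replace(3), of c] wt_last replace(2) by simp
    \<comment> \<open>A leader that stays is not a derivative of u, hence differs from
      \<open>last s\<close> and obeys the smaller bound.\<close>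
    have ne_last: "wt c v \<le> h * fib (k - Suc 0)" if "v \<in> U" "\<not> der_le u v" for v
      using wt_U[OF that(1)] that(2) replace(3) by auto
    have not_le: "\<not> der_le u x" if "x \<in> set (butlast s)" for x
      using wt_butlast[OF that] der_le_imp_wt_le[of u x c] replace(1) by auto
    show ?thesis
    proof (rule that[of "butlast s @ [u]"])
      have "antichain_seq (butlast s)"
        using antichain_seq_append[of "butlast s" "[last s]"] anti replace(2) by simp
      then have "antichain_seq (butlast s @ [u])"
        unfolding antichain_seq_snoc using incomparable[OF in_set_butlastD not_le] not_le by blast
      moreover have "wt c ((butlast s @ [u]) ! i) \<le> h * fib (Suc i)" if "i < k" for i
        using that wt_s[OF that] wt_u len
        by (cases "i = k - Suc 0") (auto simp: nth_append nth_butlast)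
      moreover have "\<exists>v\<in>?U. der_le v x" if "x \<in> set (butlast s @ [u])" for x
        using that above'[of x] in_set_butlastD[of x s] by (cases "x = u") simp_all
      moreover have "wt c v \<le> h * fib (k - Suc 0) \<or> v = u" if "v \<in> ?U" for v
        using that ne_last by blast
      ultimately show "tracks c h ?U (butlast s @ [u])"
        unfolding tracks_def using len by simp
      show "wt c u + wt c v \<le> h * fib (Suc (length (butlast s @ [u])))"
        if "v \<in> U" "\<not> der_le u v" for v
        using wt_u ne_last[OF that] fib_pred len by simp
    qed (use len in \<open>simp add: k_def\<close>)
  next
    case extend
    show ?thesis
    proof (rule that[of "s @ [u]"])
      have "antichain_seq (s @ [u])"
        using anti extend(2) incomparable by (auto simp: antichain_seq_snoc)
      moreover have "wt c ((s @ [u]) ! i) \<le> h * fib (Suc i)" if "i < Suc k" for i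
        using that wt_s u by (cases "i = k") (auto simp: nth_append k_def)
      moreover have "\<exists>v\<in>?U. der_le v x" if "x \<in> set (s @ [u])" for x
        using that above'[of x] by (cases "x = u") simp_all
      moreover have "wt c v \<le> h * fib k \<or> v = u" if "v \<in> ?U" for v
        using that wt_U_le by blast
      ultimately show "tracks c h ?U (s @ [u])"
        unfolding tracks_def by (simp add: k_def)
      \<comment> \<open>The bounds h * fib (k + 1) for u and h * fib k for v add up to the bound for
        the sequence that is now longer by one.\<close>
      show "wt c u + wt c v \<le> h * fib (Suc (length (s @ [u])))" if "v \<in> U" for v
        using u wt_U_le[OF that] by (simp add: k_def algebra_simps)
    qed simp
  qed
qed


section \<open>The invariant of the algorithm\<close>

context weighted_ranking_field
begin

text \<open>For distinct derivatives u and v, the degree condition in \<open>reduced\<close> holds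
  automatically for \<open>var u\<close> and \<open>var v\<close>; what remains says that u is not a
  derivative of v. So the leaders form an antichain.\<close>

lemma weak_d_triangular_iff:
  fixes A :: "('m, 'n, 'k) dpoly set"
  shows "weak_d_triangular lt A \<longleftrightarrow>
    A \<inter> ground = {} \<and> (\<forall>a\<in>A. \<forall>b\<in>A. der_le (lead lt a) (lead lt b) \<longrightarrow> a = b)"
proof -
  have reduced_var: "reduced lt (var u :: ('m, 'n, 'k) dpoly) (var v) \<longleftrightarrow> \<not> der_le v u"
    if "u \<noteq> v" for u v
  proof -
    have "op_act (\<lambda>_. 0) v = v" by (simp add: op_act_def)
    then have "der_le v u \<longleftrightarrow> (\<exists>\<theta>. \<theta> \<noteq> (\<lambda>_. 0) \<and> op_act \<theta> v = u)"
      using that ex_op_act_iff[of u v] by metis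
    then show ?thesis
      using that by (auto simp: reduced_def partially_reduced_def deg_in_var)
  qed
  show ?thesis
  proof
    assume A: "weak_d_triangular lt A"
    have "a = b" if "a \<in> A" "b \<in> A" "der_le (lead lt a) (lead lt b)" for a b
    proof (rule ccontr)
      assume "a \<noteq> b"
      then have "lead lt a \<noteq> lead lt b"
        using A that by (auto simp: weak_d_triangular_def dest: inj_onD)
      moreover from this have "reduced lt (var (lead lt b) :: ('m, 'n, 'k) dpoly) (var (lead lt a))"
        using A that by (auto simp: weak_d_triangular_def autoreduced_def)
      ultimately show False using reduced_var that by metis
    qed
    then show "A \<inter> ground = {} \<and> (\<forall>a\<in>A. \<forall>b\<in>A. der_le (lead lt a) (lead lt b) \<longrightarrow> a = b)"
      using A by (auto simp: weak_d_triangular_def)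
  next
    assume A: "A \<inter> ground = {} \<and> (\<forall>a\<in>A. \<forall>b\<in>A. der_le (lead lt a) (lead lt b) \<longrightarrow> a = b)"
    then have eq: "a = b" if "a \<in> A" "b \<in> A" "der_le (lead lt a) (lead lt b)" for a b
      using that by blast
    then have "inj_on (lead lt) A" by (intro inj_onI) simp
    moreover have "reduced lt (var (lead lt a) :: ('m, 'n, 'k) dpoly) (var (lead lt b))"
      if "a \<in> A" "b \<in> A" "lead lt a \<noteq> lead lt b" for a b
      using reduced_var[OF that(3)] eq[OF that(2,1)] that(3) by blast
    ultimately show "weak_d_triangular lt A"
      using A unfolding weak_d_triangular_def autoreduced_def by auto
  qed
qed

text \<open>No proper derivative of \<open>lead lt g\<close> occurs in f. The leaders may still
  coincide, with f of smaller degree in the common leader.\<close>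

lemma reduced_imp_lead_le_eq:
  assumes "reduced lt f g" "f \<notin> ground" "der_le (lead lt g) (lead lt f)"
  shows "lead lt g = lead lt f"
proof -
  obtain \<theta> where \<theta>: "lead lt f = op_act \<theta> (lead lt g)"
    using assms(3) by (auto simp: ex_op_act_iff[symmetric])
  then have "op_act \<theta> (lead lt g) \<in> ders f" using lead_greatest[OF assms(2)] by metis
  then have "\<theta> = (\<lambda>_. 0)" using assms(1) by (auto simp: reduced_def partially_reduced_def)
  then show ?thesis using \<theta> by (simp add: op_act_def)
qed

text \<open>Coordinatewise max(a, b) - a is at most b, so the operator applied to p adds at most the
  weight of the leader of a, and vice versa. The separants are no heavier than p and a.\<close>

lemma weight_delta_poly:
  fixes p a :: "('m, 'n, 'k) dpoly"
  assumes "p \<notin> ground" "a \<notin> ground"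
  shows "weight c (delta_poly \<delta> lt p a) \<le> wt c (lead lt p) + wt c (lead lt a)"
proof -
  let ?u = "lead lt p" and ?v = "lead lt a"
  have lcd: "(\<Sum>i\<in>UNIV. c i * (lcd_op ?u ?v i - fst ?u i)) \<le> wt c ?v"
    "(\<Sum>i\<in>UNIV. c i * (lcd_op ?u ?v i - fst ?v i)) \<le> wt c ?u"
    by (auto simp: wt_def lcd_op_def intro!: sum_mono mult_le_mono2)
  have "weight c (dop \<delta> (\<lambda>i. lcd_op ?u ?v i - fst ?u i) p) \<le> wt c ?u + wt c ?v"
    "weight c (dop \<delta> (\<lambda>i. lcd_op ?u ?v i - fst ?v i) a) \<le> wt c ?u + wt c ?v"
    using weight_dop[of c "\<lambda>i. lcd_op ?u ?v i - fst ?u i" p]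
      weight_dop[of c "\<lambda>i. lcd_op ?u ?v i - fst ?v i" a] lcd assms
    by (simp_all add: weight_eq_wt_lead)
  moreover have "weight c (sep lt p) \<le> wt c ?u" "weight c (sep lt a) \<le> wt c ?v"
    using weight_sep[of c lt p] weight_sep[of c lt a] assms by (simp_all add: weight_eq_wt_lead)
  ultimately have
    "weight c (sep lt a * dop \<delta> (\<lambda>i. lcd_op ?u ?v i - fst ?u i) p) \<le> wt c ?u + wt c ?v"
    "weight c (sep lt p * dop \<delta> (\<lambda>i. lcd_op ?u ?v i - fst ?v i) a) \<le> wt c ?u + wt c ?v"
    by (auto intro: order.trans[OF weight_mult])
  then show ?thesis
    by (auto simp: delta_poly_def Let_def intro: order.trans[OF weight_diff])
      (simp add: weight_def ders_def)
qed

lemma tracks_imp_weight_le: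
  fixes A :: "('m, 'n, 'k) dpoly set"
  assumes "weak_d_triangular lt A" "tracks c h (lead lt ` A) s" "a \<in> A"
  shows "weight c a \<le> h * fib (length s)"
proof -
  have "a \<notin> ground" using assms(1,3) by (auto simp: weak_d_triangular_iff)
  then show ?thesis
    using tracks_imp_wt_le[OF assms(2), of "lead lt a"] assms(3) by (simp add: weight_eq_wt_lead)
qed

text \<open>The sequence is existential because each tuple has its own history. The weights in A are
  not listed: \<open>tracks\<close> already bounds them.\<close>

definition rg_invariant :: "nat \<Rightarrow> ('m, 'n, 'k) rg_tuple \<Rightarrow> bool" where
  "rg_invariant h = (\<lambda>(G, D, A, H). finite A \<and> weak_d_triangular lt A \<and>
    (\<exists>s. tracks c h (lead lt ` A) s \<and> (\<forall>g\<in>G \<union> D \<union> H. weight c g \<le> h * fib (Suc (length s)))))"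

text \<open>Reducedness of q makes its leader minimal, so \<open>tracks_insert\<close> supplies the
  new sequence. It is at least as long as the old one, so earlier bounds persist.\<close>

lemma rg_invariant_update:
  assumes inv: "rg_invariant h (G, D, A, H)"
    and q: "q \<notin> ground" "\<And>a. a \<in> A \<Longrightarrow> reduced lt q a" "weight c q \<le> weight c p" "p \<in> G \<union> D"
    and sub: "G' \<subseteq> G" "D' \<subseteq> D"
  shows "rg_invariant h (rg_update \<delta> lt G' D' A H q)"
proof -
  obtain s where A: "finite A" "weak_d_triangular lt A" and s: "tracks c h (lead lt ` A) s"
    and wt_s: "\<And>g. g \<in> G \<union> D \<union> H \<Longrightarrow> weight c g \<le> h * fib (Suc (length s))"
    using inv by (auto simp: rg_invariant_def)
  let ?u = "lead lt q"
  let ?A = "{a\<in>A. \<not> der_le ?u (lead lt a)}"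
  have ground: "a \<notin> ground" if "a \<in> A" for a using A(2) that by (auto simp: weak_d_triangular_iff)
  have wt_q: "weight c q \<le> h * fib (Suc (length s))"
    using q(3) wt_s[of p] q(4) by fastforce
  then have wt_u: "wt c ?u \<le> h * fib (Suc (length s))" using q(1) by (simp add: weight_eq_wt_lead)
  have minimal: "v = ?u" if "v \<in> lead lt ` A" "der_le v ?u" for v
    using that reduced_imp_lead_le_eq q(1,2) by blast
  obtain t where t: "length s \<le> length t"
    "tracks c h (insert ?u {v \<in> lead lt ` A. \<not> der_le ?u v}) t"
    "\<And>v. v \<in> lead lt ` A \<Longrightarrow> \<not> der_le ?u v \<Longrightarrow> wt c ?u + wt c v \<le> h * fib (Suc (length t))"
    using tracks_insert[OF s wt_u minimal] by blast
  have up: "weight c g \<le> h * fib (Suc (length t))" if "weight c g \<le> h * fib (Suc (length s))"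
    for g :: "('m, 'n, 'k) dpoly"
    by (rule order_trans[OF that]) (simp add: t(1) fib_mono)
  have "lead lt ` (?A \<union> {q}) = insert ?u {v \<in> lead lt ` A. \<not> der_le ?u v}" by auto
  then have "tracks c h (lead lt ` (?A \<union> {q})) t" using t(2) by simp
  moreover have "\<not> der_le (lead lt a) ?u" if "a \<in> ?A" for a
    using minimal[of "lead lt a"] that by auto
  then have "weak_d_triangular lt (?A \<union> {q})"
    using A(2) q(1) by (auto simp: weak_d_triangular_iff)
  \<comment> \<open>The polynomials displaced from A return to G, where their weights must obey the
    bound.\<close>
  moreover have "weight c a \<le> h * fib (Suc (length s))" if "a \<in> A" for a
    by (rule order_trans[OF tracks_imp_weight_le[OF A(2) s that]]) (intro mult_le_mono2 fib_mono, simp)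
  moreover have "weight c (delta_poly \<delta> lt q a) \<le> h * fib (Suc (length t))" if "a \<in> ?A" for a
    using weight_delta_poly[OF q(1) ground, of a] t(3)[of "lead lt a"] that by fastforce
  moreover have "weight c (sep lt q) \<le> h * fib (Suc (length s))"
    "weight c (init lt q) \<le> h * fib (Suc (length s))"
    using weight_sep weight_init wt_q order_trans by blast+
  moreover have "A - {a\<in>A. der_le ?u (lead lt a)} = ?A" by auto
  ultimately show ?thesis
    using A(1) wt_s sub up
    unfolding rg_invariant_def rg_update_def Let_def ex_op_act_iff prod.case
    by (intro conjI exI[of _ t]) auto
qed

text \<open>Serves the tuples with unchanged A: the same sequence remains a witness.\<close>

lemma rg_invariant_mono:
  assumes "rg_invariant h (G, D, A, H)"
    and "\<And>g. g \<in> G' \<union> D' \<union> H' \<Longrightarrow> \<exists>p\<in>G \<union> D \<union> H. weight c g \<le> weight c p"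
  shows "rg_invariant h (G', D', A, H')"
  using assms order_trans unfolding rg_invariant_def prod.case by meson


section \<open>The output\<close>

text \<open>Were the heads different, each would precede the other. By irreflexivity the head does
  not recur in the tail, so the tails have equal sets as well.\<close>

lemma sorted_wrt_unique:
  assumes "\<And>x y. P x y \<Longrightarrow> \<not> P y x"
    and "sorted_wrt P xs" "sorted_wrt P ys" "set xs = set ys"
  shows "xs = ys"
  using assms(2-)
proof (induction xs arbitrary: ys)
  case (Cons x xs)
  then obtain y zs where ys: "ys = y # zs" by (cases ys) auto
  have "x = y" using Cons.prems ys assms(1) by (metis insert_iff list.simps(15) sorted_wrt.simps(2))
  moreover from this have "set xs = set zs"
    using Cons.prems ys assms(1) by (metis insert_ident list.simps(15) sorted_wrt.simps(2))
  ultimately show ?case using Cons ys by simp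
qed simp

text \<open>This justifies the \<open>THE\<close>: a list is built by appending the element with the
  greatest leader to a list of the others, and sorted lists are unique.\<close>

lemma by_increasing_leader:
  fixes A :: "('m, 'n, 'k) dpoly set"
  assumes "finite A" "inj_on (lead lt) A"
  shows "set (by_increasing_leader lt A) = A \<and>
    sorted_wrt (\<lambda>a b. lt (lead lt a) (lead lt b)) (by_increasing_leader lt A)"
proof -
  have "\<exists>as. set as = A \<and> sorted_wrt (\<lambda>a b. lt (lead lt a) (lead lt b)) as"
    using assms
  proof (induction A rule: finite_psubset_induct)
    case (psubset A)
    show ?case
    proof (cases "A = {}")
      case False
      then obtain a where a: "a \<in> A" "\<And>v. v \<in> lead lt ` A \<Longrightarrow> v \<noteq> lead lt a \<Longrightarrow> lt v (lead lt a)"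
        using ex_lt_greatest[of "lead lt ` A"] psubset(1) by blast
      have "A - {a} \<subset> A" "inj_on (lead lt) (A - {a})"
        using a(1) psubset(3) by (auto intro: inj_on_subset)
      then obtain as where as: "set as = A - {a}" "sorted_wrt (\<lambda>a b. lt (lead lt a) (lead lt b)) as"
        using psubset(2) by blast
      have "lt (lead lt b) (lead lt a)" if "b \<in> A - {a}" for b
        using that a inj_onD[OF psubset(3), of b a] by blast
      then have "set (as @ [a]) = A \<and> sorted_wrt (\<lambda>a b. lt (lead lt a) (lead lt b)) (as @ [a])"
        using as a(1) by (auto simp: sorted_wrt_append)
      then show ?thesis by blast
    qed simp
  qed
  then obtain as where as: "set as = A \<and> sorted_wrt (\<lambda>a b. lt (lead lt a) (lead lt b)) as" ..
  then show ?thesis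
    unfolding by_increasing_leader_def
  proof (rule theI)
    fix bs assume "set bs = A \<and> sorted_wrt (\<lambda>a b. lt (lead lt a) (lead lt b)) bs"
    then show "bs = as"
      using as lt_irrefl lt_trans
      by (intro sorted_wrt_unique[of "\<lambda>a b. lt (lead lt a) (lead lt b)"]) blast+
  qed
qed

text \<open>Equal rank means equal leader, so replacing a by its reduction keeps the leaders
  pairwise incomparable. Thus B stays weak d-triangular and the specification of
  \<open>pd_red\<close> applies at each turn.\<close>

lemma pd_reduce_all_weight:
  fixes pd_red :: "('m, 'n, 'k) dpoly \<Rightarrow> ('m, 'n, 'k) dpoly set \<Rightarrow> ('m, 'n, 'k) dpoly"
  assumes "pd_reduction \<delta> lt pd_red"
    and "pd_reduce_all lt pd_red B as = Some B'"
    and "finite B" "weak_d_triangular lt B" "set as \<inter> ground = {}"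
    and "sorted_wrt (\<lambda>a b. \<not> der_le (lead lt a) (lead lt b) \<and> \<not> der_le (lead lt b) (lead lt a)) as"
    and "\<And>a b. a \<in> set as \<Longrightarrow> b \<in> B \<Longrightarrow>
      \<not> der_le (lead lt a) (lead lt b) \<and> \<not> der_le (lead lt b) (lead lt a)"
    and "\<And>g. g \<in> B \<union> set as \<Longrightarrow> weight c g \<le> N"
  shows "finite B' \<and> weak_d_triangular lt B' \<and> (\<forall>b\<in>B'. weight c b \<le> N)"
  using assms(2-)
proof (induction as arbitrary: B)
  case (Cons a as)
  define b where "b = pd_red a B"
  have b: "b \<notin> ground" "rank lt b = rank lt a" "pd_reduce_all lt pd_red (insert b B) as = Some B'"
    using Cons.prems(1) unfolding b_def by (simp_all add: Let_def split: if_splits)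
  have lead: "lead lt b = lead lt a"
    using lead_eq_if_rank_eq[OF b(1) _ b(2)] Cons.prems(4) by simp
  have "rank_not_above lt b a"
    using assms(1) Cons.prems(2,3) by (simp add: pd_reduction_def b_def)
  then have "weight c b \<le> N"
    using weight_le_if_rank_not_above[of b a] Cons.prems(7)[of a] by simp
  moreover have "weak_d_triangular lt (insert b B)"
    using Cons.prems(3,6) b(1) by (auto simp: weak_d_triangular_iff lead)
  ultimately show ?case
    using Cons.prems by (intro Cons.IH[OF b(3)]) (auto simp: lead)
qed simp

lemma auto_partial_reduce_weight:
  fixes pd_red :: "('m, 'n, 'k) dpoly \<Rightarrow> ('m, 'n, 'k) dpoly set \<Rightarrow> ('m, 'n, 'k) dpoly"
  assumes pd: "pd_reduction \<delta> lt pd_red" and A: "finite A" "weak_d_triangular lt A"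
    and N: "\<And>g. g \<in> A \<union> H \<Longrightarrow> weight c g \<le> N"
    and BK: "(B, K) \<in> auto_partial_reduce lt pd_red A H" and g: "g \<in> B \<union> K"
  shows "weight c g \<le> N"
proof -
  let ?as = "by_increasing_leader lt A"
  have as: "set ?as = A" "sorted_wrt (\<lambda>a b. lt (lead lt a) (lead lt b)) ?as"
    using by_increasing_leader[of A] A by (auto simp: weak_d_triangular_def)
  have B: "pd_reduce_all lt pd_red {} ?as = Some B"
    and K: "K = inits_seps lt B \<union> {pd_red q B |q. q \<in> H - inits_seps lt A}"
    using BK by (auto simp: auto_partial_reduce_def Let_def split: option.splits if_splits)
  \<comment> \<open>Comparable leaders would belong to the same element, whose leader would then
    rank below itself.\<close>
  have "sorted_wrt (\<lambda>a b. \<not> der_le (lead lt a) (lead lt b) \<and> \<not> der_le (lead lt b) (lead lt a)) ?as"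
    using as(2)
  proof (rule sorted_wrt_mono_rel[rotated])
    fix a b assume "a \<in> set ?as" "b \<in> set ?as" "lt (lead lt a) (lead lt b)"
    then show "\<not> der_le (lead lt a) (lead lt b) \<and> \<not> der_le (lead lt b) (lead lt a)"
      using A(2) as(1) lt_irrefl unfolding weak_d_triangular_iff by metis
  qed
  then have B': "finite B" "weak_d_triangular lt B" "\<And>b. b \<in> B \<Longrightarrow> weight c b \<le> N"
    using pd_reduce_all_weight[OF pd B, of N] A(2) N as(1) by (auto simp: weak_d_triangular_iff)
  have "weight c (pd_red q B) \<le> N" if "q \<in> H" for q
  proof -
    have "rank_not_above lt (pd_red q B) q" using pd B'(1,2) by (simp add: pd_reduction_def)
    then show ?thesis using weight_le_if_rank_not_above[of "pd_red q B" q] N[of q] that by simp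
  qed
  moreover have "weight c x \<le> N" if "x \<in> inits_seps lt B" for x
    using that unfolding inits_seps_def
    by (auto intro: order_trans[OF weight_init B'(3)] order_trans[OF weight_sep B'(3)])
  ultimately show ?thesis using g B'(3) by (auto simp: K)
qed

text \<open>L is any common bound on the lengths of tracking sequences. Only the case
  \<open>finish\<close> changes \<open>Out\<close>, and there the invariant becomes a bound on the
  output.\<close>

lemma rg_step_invariant:
  fixes d_red pd_red :: "('m, 'n, 'k) dpoly \<Rightarrow> ('m, 'n, 'k) dpoly set \<Rightarrow> ('m, 'n, 'k) dpoly"
  assumes step: "rg_step \<delta> lt d_red pd_red (S, Out) (S', Out')"
    and d: "d_reduction \<delta> lt d_red" and pd: "pd_reduction \<delta> lt pd_red"
    and L: "\<And>(U :: ('m, 'n) der set) s. tracks c h U s \<Longrightarrow> length s \<le> L"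
    and S: "\<And>T. T \<in> S \<Longrightarrow> rg_invariant h T"
    and Out: "\<And>B K g. (B, K) \<in> Out \<Longrightarrow> g \<in> B \<union> K \<Longrightarrow> weight c g \<le> h * fib (L + 1)"
  shows "(\<forall>T\<in>S'. rg_invariant h T) \<and>
    (\<forall>(B, K)\<in>Out'. \<forall>g\<in>B \<union> K. weight c g \<le> h * fib (L + 1))"
  using step
proof (cases rule: rg_step.cases)
  case (finish G D A H)
  obtain s where A: "finite A" "weak_d_triangular lt A" and s: "tracks c h (lead lt ` A) s"
    and wt_s: "\<And>g. g \<in> H \<Longrightarrow> weight c g \<le> h * fib (Suc (length s))"
    using S[OF finish(3)] by (auto simp: rg_invariant_def)
  have fib_L: "h * fib i \<le> h * fib (L + 1)" if "i \<le> Suc (length s)" for i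
    using L[OF s] that by (intro mult_le_mono2 fib_mono) simp
  have "weight c a \<le> h * fib (L + 1)" if "a \<in> A" for a
    by (rule order_trans[OF tracks_imp_weight_le[OF A(2) s that] fib_L]) simp
  then have "weight c g \<le> h * fib (L + 1)" if "g \<in> A \<union> H" for g
    using that order_trans[OF wt_s fib_L] by blast
  from auto_partial_reduce_weight[OF pd A this] show ?thesis
    using finish S Out by blast
next
  case (vanish G D A H p)
  have "rg_invariant h (G - {p}, D - {p}, A, H)"
    by (rule rg_invariant_mono[OF S[OF vanish(3)]]) auto
  then show ?thesis using vanish S Out by blast
next
  case (scalar G D A H p)
  then show ?thesis using S Out by blast
next
  case (branch G D A H p q qi qs)
  have inv: "rg_invariant h (G, D, A, H)" using S branch by blast
  then have "finite A" "weak_d_triangular lt A" by (auto simp: rg_invariant_def)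
  then have q: "\<And>a. a \<in> A \<Longrightarrow> reduced lt q a" "rank_not_above lt q p"
    using d branch by (simp_all add: d_reduction_def)
  have wt_q: "weight c q \<le> weight c p" by (rule weight_le_if_rank_not_above[OF q(2)])
  \<comment> \<open>The last two tuples gain only polynomials whose derivatives all occur in q, so
    none is heavier than p.\<close>
  have "lead lt q \<in> ders q" using lead_greatest branch by blast
  then have "ders (rank lt q) \<subseteq> ders q"
    unfolding rank_def by (intro order.trans[OF ders_power]) simp
  moreover have "ders (init lt q) \<subseteq> ders q" "ders (sep lt q) \<subseteq> ders q"
    by (simp_all add: init_def sep_def ders_coeff_in ders_partial_der)
  moreover have "ders (var (lead lt q) * sep lt q) \<subseteq> ders q"
    using ders_mult[of "var (lead lt q)" "sep lt q"] \<open>lead lt q \<in> ders q\<close> calculation(3) by auto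
  ultimately have "ders qi \<subseteq> ders q" "ders qs \<subseteq> ders q"
    using ders_diff[of q "init lt q * rank lt q"] ders_mult[of "init lt q" "rank lt q"]
      ders_diff[of "of_nat (deg_in (lead lt q) q) * q" "var (lead lt q) * sep lt q"]
      ders_of_nat_mult[of "deg_in (lead lt q) q" q]
    unfolding branch by blast+
  then have wt: "weight c qi \<le> weight c p" "weight c qs \<le> weight c p"
    "weight c (init lt q) \<le> weight c p" "weight c (sep lt q) \<le> weight c p"
    using weight_mono weight_init weight_sep wt_q order_trans by meson+
  have "rg_invariant h (rg_update \<delta> lt (G - {p}) (D - {p}) A H q)"
    using inv branch(6) q(1) wt_q branch(4) by (rule rg_invariant_update) auto
  moreover have "rg_invariant h ((G - {p}) \<union> {qs, sep lt q}, D - {p}, A, H \<union> {init lt q})"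
    "rg_invariant h ((G - {p}) \<union> {qi, init lt q}, D - {p}, A, H)"
    using wt branch(4) by (auto intro!: rg_invariant_mono[OF inv])
  ultimately show ?thesis using branch(1,2) S Out by blast
qed

end

text \<open>Each \<open>c i\<close> is at least 1, so a weight bound is also a degree bound and
  \<open>s\<close> competes for the maximal length.\<close>

lemma tracks_length_le:
  fixes c :: "'m::finite \<Rightarrow> nat" and U :: "('m, 'n::finite) der set"
  assumes pos: "\<And>i. 0 < c i" and s: "tracks c h U s"
  shows "length s \<le> max_antichain_length TYPE('m) TYPE('n) (\<lambda>i. h * fib i)"
proof (rule length_le_max_antichain_length)
  show "antichain_seq s" using s by (simp add: tracks_def)
  have "der_degree x \<le> wt c x" for x :: "('m, 'n) der"
    unfolding der_degree_def wt_def using pos by (intro sum_mono) (simp add: Suc_leI)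
  then show "degree_growth_bounded (\<lambda>i. h * fib i) s"
    using s order_trans unfolding tracks_def degree_growth_bounded_def Suc_eq_plus1 by blast
qed

theorem theorem27:
  fixes \<delta> :: "'m::finite \<Rightarrow> 'k::field_char_0 \<Rightarrow> 'k"
    and c :: "'m \<Rightarrow> nat"
    and lt :: "('m, 'n::finite) der \<Rightarrow> ('m, 'n) der \<Rightarrow> bool"
    and d_red pd_red ::
      "('m, 'n, 'k) dpoly \<Rightarrow> ('m, 'n, 'k) dpoly set \<Rightarrow> ('m, 'n, 'k) dpoly"
    and F K :: "('m, 'n, 'k) dpoly set"
    and \<A> :: "(('m, 'n, 'k) dpoly set \<times> ('m, 'n, 'k) dpoly set) set"
    and h L :: nat
    and f :: "nat \<Rightarrow> nat"
  assumes "differential_field \<delta>"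
    and "\<And>i. 0 < c i"
    and "weighted_ranking c lt"
    and "d_reduction \<delta> lt d_red"
    and "pd_reduction \<delta> lt pd_red"
    and "finite F" and "finite K"
    and "h = max_weight c (F \<union> K)"
    and "\<And>i. f i = h * fib i"
    and "L = max_antichain_length TYPE('m) TYPE('n) f"
    and "rosenfeld_groebner \<delta> lt d_red pd_red F K \<A>"
  shows "max_weight c (\<Union>(A, H)\<in>\<A>. A \<union> H) \<le> h * fib (L + 1)"
proof -
  interpret weighted_ranking_field \<delta> c lt
    using assms(1-3) by (simp add: weighted_ranking_field_def weighted_ranking_field_axioms_def)
  have "f = (\<lambda>i. h * fib i)" using assms(9) by auto
  then have L: "length s \<le> L" if "tracks c h U s" for s and U :: "('m, 'n) der set"
    using tracks_length_le[OF assms(2) that] assms(10) by simp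
  \<comment> \<open>The initial A is empty and tracked by the empty sequence, whose bound h * fib 1
    = h holds by the choice of h.\<close>
  have "tracks c h (lead lt ` {}) []" by (simp add: tracks_def antichain_seq_def)
  moreover have "weight c g \<le> h" if "g \<in> F \<union> K" for g
    unfolding assms(8) using that assms(6,7) by (intro weight_le_max_weight) auto
  moreover have "weak_d_triangular lt ({} :: ('m, 'n, 'k) dpoly set)"
    by (simp add: weak_d_triangular_iff)
  ultimately have init: "rg_invariant h (F, {}, {}, K)"
    unfolding rg_invariant_def prod.case by (intro conjI exI[of _ "[]"]) auto
  \<comment> \<open>The claim is proved for every reachable state, whatever choices the run makes,
    and then read off at the final one.\<close>
  have "(\<forall>T\<in>S. rg_invariant h T) \<and>
    (\<forall>(B, K)\<in>Out. \<forall>g\<in>B \<union> K. weight c g \<le> h * fib (L + 1))"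
    if "(rg_step \<delta> lt d_red pd_red)\<^sup>*\<^sup>* ({(F, {}, {}, K)}, {}) (S, Out)" for S Out
    using that
  proof (induction rule: rtranclp_induct2)
    case refl
    then show ?case using init by simp
  next
    case (step S Out S' Out')
    show ?case
      by (rule rg_step_invariant[OF step(2) assms(4,5) L]) (use step(3) in auto)
  qed
  then have "\<forall>(B, K)\<in>\<A>. \<forall>g\<in>B \<union> K. weight c g \<le> h * fib (L + 1)"
    using assms(11) unfolding rosenfeld_groebner_def by blast
  then show ?thesis by (intro max_weight_le) auto
qed

end
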